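(* Let $G$ be a finite noncyclic group. Then the poset $\overline{L}(G)$ of conjugacy classes of subgroups of $G$ has a breaking point if and only if $G$ is a generalized quaternion $2$-group.
   Context: For a finite group $G$ and a subgroup $H\leq G$, let $[H]=\{H^x \mid x\in G\}$ be the conjugacy class of $H$, and let $\overline{L}(G)=\{[H]\mid H\leq G\}$, partially ordered by $[H_1]\leq [H_2]$ if and only if $H_1\subseteq H_2^x$ for some $x\in G$. A breaking point of $\overline{L}(G)$ is an element $[H]\in\overline{L}(G)$ with $1\neq H\neq G$ such that for every $[X]\in\overline{L}(G)$ we have either $[X]\leq [H]$ or $[H]\leq [X]$. The generalized quaternion $2$-groups are the groups $Q_{2^n}=\langle a,b \mid a^{2^{n-2}}= b^2,\ a^{2^{n-1}}=1,\ b^{-1}ab=a^{-1}\rangle$ with $n\geq 3$. *)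

theory Defs
  imports "HOL-Algebra.Elementary_Groups"
begin

section \<open>Conjugacy classes of subgroups\<close>

definition conj_subgroup :: "('a, 'b) monoid_scheme \<Rightarrow> 'a set \<Rightarrow> 'a \<Rightarrow> 'a set" where
  "conj_subgroup G H x = (inv\<^bsub>G\<^esub> x) <#\<^bsub>G\<^esub> H #>\<^bsub>G\<^esub> x"

definition subgroup_conj_class :: "('a, 'b) monoid_scheme \<Rightarrow> 'a set \<Rightarrow> 'a set set" where
  "subgroup_conj_class G H = {conj_subgroup G H x | x. x \<in> carrier G}"

definition subgroup_class_poset :: "('a, 'b) monoid_scheme \<Rightarrow> 'a set set gorder" where
  "subgroup_class_poset G =
     \<lparr>carrier = {subgroup_conj_class G H | H. subgroup H G},
      eq = (=),
      le = (\<lambda>\<A> \<B>. \<exists>H1 H2. subgroup H1 G \<and> subgroup H2 G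
             \<and> \<A> = subgroup_conj_class G H1 \<and> \<B> = subgroup_conj_class G H2
             \<and> (\<exists>x\<in>carrier G. H1 \<subseteq> conj_subgroup G H2 x))\<rparr>"

definition is_breaking_point :: "('a, 'b) monoid_scheme \<Rightarrow> 'a set set \<Rightarrow> bool" where
  "is_breaking_point G \<H> \<longleftrightarrow>
     (\<exists>H. subgroup H G \<and> \<H> = subgroup_conj_class G H \<and> H \<noteq> {\<one>\<^bsub>G\<^esub>} \<and> H \<noteq> carrier G)
     \<and> (\<forall>\<X>\<in>carrier (subgroup_class_poset G).
          \<X> \<sqsubseteq>\<^bsub>subgroup_class_poset G\<^esub> \<H> \<or> \<H> \<sqsubseteq>\<^bsub>subgroup_class_poset G\<^esub> \<X>)"

context group
begin

lemma conj_subgroup_altdef: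
  "conj_subgroup G H x = (\<lambda>h. inv x \<otimes> h \<otimes> x) ` H"
  by (auto simp: conj_subgroup_def l_coset_def r_coset_def)

lemma conj_subgroup_one: "H \<subseteq> carrier G \<Longrightarrow> conj_subgroup G H \<one> = H"
  by (force simp: conj_subgroup_altdef)

lemma conj_subgroup_mult:
  assumes "H \<subseteq> carrier G" "x \<in> carrier G" "y \<in> carrier G"
  shows "conj_subgroup G (conj_subgroup G H x) y = conj_subgroup G H (x \<otimes> y)"
  unfolding conj_subgroup_altdef image_image
  by (rule image_cong) (use assms in \<open>auto simp: m_assoc inv_mult_group\<close>)

lemma conj_subgroup_mono: "H \<subseteq> K \<Longrightarrow> conj_subgroup G H x \<subseteq> conj_subgroup G K x"
  by (auto simp: conj_subgroup_altdef)

lemma conj_subgroup_closed: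
  "H \<subseteq> carrier G \<Longrightarrow> x \<in> carrier G \<Longrightarrow> conj_subgroup G H x \<subseteq> carrier G"
  by (auto simp: conj_subgroup_altdef)

lemma card_conj_subgroup:
  assumes "H \<subseteq> carrier G" "x \<in> carrier G"
  shows "card (conj_subgroup G H x) = card H"
  unfolding conj_subgroup_altdef
  by (rule card_image, rule inj_onI) (use assms in \<open>auto simp: subset_iff\<close>)

lemma subgroup_conj_class_refl: "H \<subseteq> carrier G \<Longrightarrow> H \<in> subgroup_conj_class G H"
  unfolding subgroup_conj_class_def using conj_subgroup_one by blast

lemma subgroup_conj_class_conj:
  assumes H: "H \<subseteq> carrier G" and x: "x \<in> carrier G"
  shows "subgroup_conj_class G (conj_subgroup G H x) = subgroup_conj_class G H"
proof -
  have "(\<lambda>z. x \<otimes> z) ` carrier G = carrier G"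
    using x by (rule surj_const_mult)
  then have "conj_subgroup G H ` carrier G = (\<lambda>z. conj_subgroup G H (x \<otimes> z)) ` carrier G"
    by (metis image_image)
  then show ?thesis
    using assms by (simp add: subgroup_conj_class_def Setcompr_eq_image conj_subgroup_mult)
qed

lemma subgroup_conj_class_eqD:
  assumes "H \<subseteq> carrier G" "subgroup_conj_class G H = subgroup_conj_class G K"
  shows "\<exists>x\<in>carrier G. H = conj_subgroup G K x"
proof -
  have "H \<in> subgroup_conj_class G K"
    using subgroup_conj_class_refl[OF assms(1)] assms(2) by simp
  then show ?thesis by (auto simp: subgroup_conj_class_def)
qed

lemma subgroup_class_le_iff:
  assumes H: "subgroup H G" and K: "subgroup K G"
  shows "subgroup_conj_class G H \<sqsubseteq>\<^bsub>subgroup_class_poset G\<^esub> subgroup_conj_class G K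
    \<longleftrightarrow> (\<exists>x\<in>carrier G. H \<subseteq> conj_subgroup G K x)" (is "?L \<longleftrightarrow> ?R")
proof
  assume ?L
  then obtain H1 K1 x where *: "subgroup H1 G" "subgroup K1 G"
      "subgroup_conj_class G H = subgroup_conj_class G H1"
      "subgroup_conj_class G K = subgroup_conj_class G K1"
      "x \<in> carrier G" "H1 \<subseteq> conj_subgroup G K1 x"
    by (auto simp: subgroup_class_poset_def)
  obtain y where y: "y \<in> carrier G" "H = conj_subgroup G H1 y"
    using subgroup_conj_class_eqD[OF subgroup.subset[OF H] *(3)] by blast
  obtain z where z: "z \<in> carrier G" "K1 = conj_subgroup G K z"
    using subgroup_conj_class_eqD[OF subgroup.subset[OF *(2)] *(4)[symmetric]] by blast
  have "H \<subseteq> conj_subgroup G (conj_subgroup G (conj_subgroup G K z) x) y"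
    using y z * by (metis conj_subgroup_mono)
  then have "H \<subseteq> conj_subgroup G K (z \<otimes> x \<otimes> y)"
    using y(1) z(1) *(5) subgroup.subset[OF K] by (simp add: conj_subgroup_mult)
  then show ?R using y z * by blast
next
  assume ?R then show ?L using assms by (auto simp: subgroup_class_poset_def)
qed

lemma partial_order_subgroup_class_poset:
  assumes fin: "finite (carrier G)"
  shows "partial_order (subgroup_class_poset G)"
proof -
  let ?P = "subgroup_class_poset G"
  have carr: "X \<in> carrier ?P \<longleftrightarrow> (\<exists>H. X = subgroup_conj_class G H \<and> subgroup H G)" for X
    by (auto simp: subgroup_class_poset_def)
  have eq: "X .=\<^bsub>?P\<^esub> Y \<longleftrightarrow> X = Y" for X Y
    by (simp add: subgroup_class_poset_def)
  have refl: "X \<sqsubseteq>\<^bsub>?P\<^esub> X" if X: "X \<in> carrier ?P" for X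
  proof -
    obtain H where H: "X = subgroup_conj_class G H" "subgroup H G" using X carr by blast
    have "H \<subseteq> conj_subgroup G H \<one>"
      using conj_subgroup_one[OF subgroup.subset[OF H(2)]] by simp
    then show ?thesis using subgroup_class_le_iff[OF H(2) H(2)] H(1) one_closed by blast
  qed
  have antisym: "X = Y"
    if X: "X \<in> carrier ?P" and Y: "Y \<in> carrier ?P" and XY: "X \<sqsubseteq>\<^bsub>?P\<^esub> Y" and YX: "Y \<sqsubseteq>\<^bsub>?P\<^esub> X" for X Y
  proof -
    obtain H where H: "X = subgroup_conj_class G H" "subgroup H G" using X carr by blast
    obtain K where K: "Y = subgroup_conj_class G K" "subgroup K G" using Y carr by blast
    note sub = subgroup.subset[OF H(2)] subgroup.subset[OF K(2)]
    obtain x where x: "x \<in> carrier G" "H \<subseteq> conj_subgroup G K x"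
      using XY subgroup_class_le_iff[OF H(2) K(2)] H(1) K(1) by blast
    obtain y where y: "y \<in> carrier G" "K \<subseteq> conj_subgroup G H y"
      using YX subgroup_class_le_iff[OF K(2) H(2)] H(1) K(1) by blast
    have fins: "finite (conj_subgroup G K x)" "finite (conj_subgroup G H y)"
      using sub x y fin conj_subgroup_closed finite_subset by metis+
    have "card K \<le> card H"
      using card_mono[OF fins(2) y(2)] card_conj_subgroup[OF sub(1) y(1)] by simp
    then have "H = conj_subgroup G K x"
      using card_seteq[OF fins(1) x(2)] card_conj_subgroup[OF sub(2) x(1)] by simp
    then show ?thesis using H K subgroup_conj_class_conj[OF sub(2) x(1)] by simp
  qed
  have trans: "X \<sqsubseteq>\<^bsub>?P\<^esub> Z"
    if X: "X \<in> carrier ?P" and Y: "Y \<in> carrier ?P" and Z: "Z \<in> carrier ?P"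
      and XY: "X \<sqsubseteq>\<^bsub>?P\<^esub> Y" and YZ: "Y \<sqsubseteq>\<^bsub>?P\<^esub> Z" for X Y Z
  proof -
    obtain H where H: "X = subgroup_conj_class G H" "subgroup H G" using X carr by blast
    obtain K where K: "Y = subgroup_conj_class G K" "subgroup K G" using Y carr by blast
    obtain L where L: "Z = subgroup_conj_class G L" "subgroup L G" using Z carr by blast
    obtain x where x: "x \<in> carrier G" "H \<subseteq> conj_subgroup G K x"
      using XY subgroup_class_le_iff[OF H(2) K(2)] H(1) K(1) by blast
    obtain y where y: "y \<in> carrier G" "K \<subseteq> conj_subgroup G L y"
      using YZ subgroup_class_le_iff[OF K(2) L(2)] K(1) L(1) by blast
    have "H \<subseteq> conj_subgroup G L (y \<otimes> x)"
      using x(2) conj_subgroup_mono[OF y(2), of x]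
        conj_subgroup_mult[OF subgroup.subset[OF L(2)] y(1) x(1)] by blast
    then show ?thesis
      using subgroup_class_le_iff[OF H(2) L(2)] H(1) L(1) x(1) y(1) m_closed by blast
  qed
  show ?thesis
  proof
    show "A \<sqsubseteq>\<^bsub>?P\<^esub> C" if "A \<sqsubseteq>\<^bsub>?P\<^esub> B" "B \<sqsubseteq>\<^bsub>?P\<^esub> C"
      "A \<in> carrier ?P" "B \<in> carrier ?P" "C \<in> carrier ?P" for A B C
      using trans that by blast
    show "(.=\<^bsub>?P\<^esub>) = (=)"
      by (simp add: subgroup_class_poset_def)
  qed (simp_all add: eq refl antisym)
qed

end

section \<open>Group presentations\<close>

text \<open>A word over the generators and their formal inverses; the letter \<open>(x, True)\<close> stands for
  the generator \<open>x\<close> and \<open>(x, False)\<close> for its inverse. A set of relations \<open>u = v\<close> is given as a set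
  of pairs of words.\<close>

type_synonym 'g word = "('g \<times> bool) list"

inductive pres_eq :: "('g word \<times> 'g word) set \<Rightarrow> 'g word \<Rightarrow> 'g word \<Rightarrow> bool"
  for R where
  rel: "(u, v) \<in> R \<Longrightarrow> pres_eq R u v"
| cancel: "pres_eq R [(x, e), (x, \<not> e)] []"
| refl: "pres_eq R u u"
| sym: "pres_eq R u v \<Longrightarrow> pres_eq R v u"
| trans: "pres_eq R u v \<Longrightarrow> pres_eq R v w \<Longrightarrow> pres_eq R u w"
| append: "pres_eq R u u' \<Longrightarrow> pres_eq R v v' \<Longrightarrow> pres_eq R (u @ v) (u' @ v')"

definition pres_class :: "('g word \<times> 'g word) set \<Rightarrow> 'g word \<Rightarrow> 'g word set" where
  "pres_class R u = {v. pres_eq R u v}"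

definition presented_group :: "('g word \<times> 'g word) set \<Rightarrow> 'g word set monoid" where
  "presented_group R =
     \<lparr>carrier = range (pres_class R),
      monoid.mult = (\<lambda>A B. \<Union>u\<in>A. \<Union>v\<in>B. pres_class R (u @ v)),
      one = pres_class R []\<rparr>"

lemma pres_class_eq_iff: "pres_class R u = pres_class R v \<longleftrightarrow> pres_eq R u v"
  by (auto simp: pres_class_def set_eq_iff intro: pres_eq.intros)

lemma mult_presented_group:
  "pres_class R u \<otimes>\<^bsub>presented_group R\<^esub> pres_class R v = pres_class R (u @ v)"
  by (auto simp: presented_group_def pres_class_def intro: pres_eq.intros)

lemma pres_eq_inverse_word:
  "pres_eq R (map (\<lambda>(x, e). (x, \<not> e)) (rev u) @ u) []"
proof (induction u)
  case Nil show ?case by (simp add: pres_eq.refl)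
next
  case (Cons l u)
  obtain x e where l: "l = (x, e)" by force
  let ?i = "map (\<lambda>(x, e). (x, \<not> e)) (rev u)"
  have "pres_eq R ([(x, \<not> e), (x, e)] @ u) ([] @ u)"
    by (rule pres_eq.append[OF _ pres_eq.refl]) (use pres_eq.cancel[of R x "\<not> e"] in simp)
  then have "pres_eq R (?i @ [(x, \<not> e), (x, e)] @ u) (?i @ [] @ u)"
    by (rule pres_eq.append[OF pres_eq.refl])
  then show ?case using Cons.IH by (auto simp: l intro: pres_eq.trans)
qed

lemma group_presented_group: "group (presented_group R)"
proof (rule groupI)
  fix A assume "A \<in> carrier (presented_group R)"
  then obtain u where u: "A = pres_class R u" by (auto simp: presented_group_def)
  have "pres_class R (map (\<lambda>(x, e). (x, \<not> e)) (rev u)) \<otimes>\<^bsub>presented_group R\<^esub> A = \<one>\<^bsub>presented_group R\<^esub>"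
    unfolding u mult_presented_group
    by (simp add: presented_group_def pres_class_eq_iff pres_eq_inverse_word)
  then show "\<exists>B\<in>carrier (presented_group R). B \<otimes>\<^bsub>presented_group R\<^esub> A = \<one>\<^bsub>presented_group R\<^esub>"
    by (auto simp: presented_group_def)
next
  fix A assume "A \<in> carrier (presented_group R)"
  then obtain u where u: "A = pres_class R u" by (auto simp: presented_group_def)
  have "\<one>\<^bsub>presented_group R\<^esub> = pres_class R []" by (simp add: presented_group_def)
  then show "\<one>\<^bsub>presented_group R\<^esub> \<otimes>\<^bsub>presented_group R\<^esub> A = A"
    by (simp add: u mult_presented_group)
next
  fix A B C assume "A \<in> carrier (presented_group R)" "B \<in> carrier (presented_group R)"
    "C \<in> carrier (presented_group R)"
  then obtain u v w where "A = pres_class R u" "B = pres_class R v" "C = pres_class R w"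
    by (auto simp: presented_group_def)
  then show "A \<otimes>\<^bsub>presented_group R\<^esub> B \<otimes>\<^bsub>presented_group R\<^esub> C = A \<otimes>\<^bsub>presented_group R\<^esub> (B \<otimes>\<^bsub>presented_group R\<^esub> C)"
    by (simp add: mult_presented_group)
next
  fix A B assume "A \<in> carrier (presented_group R)" "B \<in> carrier (presented_group R)"
  then obtain u v where "A = pres_class R u" "B = pres_class R v"
    by (auto simp: presented_group_def)
  then have "A \<otimes>\<^bsub>presented_group R\<^esub> B = pres_class R (u @ v)"
    by (simp add: mult_presented_group)
  then show "A \<otimes>\<^bsub>presented_group R\<^esub> B \<in> carrier (presented_group R)"
    by (simp add: presented_group_def)
qed (simp add: presented_group_def)

primrec word_eval :: "('a, 'b) monoid_scheme \<Rightarrow> ('g \<Rightarrow> 'a) \<Rightarrow> 'g word \<Rightarrow> 'a" where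
  "word_eval G f [] = \<one>\<^bsub>G\<^esub>"
| "word_eval G f (l # u) =
     (if snd l then f (fst l) else inv\<^bsub>G\<^esub> (f (fst l))) \<otimes>\<^bsub>G\<^esub> word_eval G f u"

context group
begin

lemma word_eval_closed: "range f \<subseteq> carrier G \<Longrightarrow> word_eval G f u \<in> carrier G"
  by (induction u) auto

lemma word_eval_append:
  assumes "range f \<subseteq> carrier G"
  shows "word_eval G f (u @ v) = word_eval G f u \<otimes> word_eval G f v"
  using assms by (induction u) (auto simp: word_eval_closed m_assoc range_subsetD)

lemma word_eval_pres_eq:
  assumes "range f \<subseteq> carrier G" "\<And>u v. (u, v) \<in> R \<Longrightarrow> word_eval G f u = word_eval G f v"
    and "pres_eq R u v"
  shows "word_eval G f u = word_eval G f v"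
  using assms(3)
proof induction
  case (cancel x e)
  have "f x \<in> carrier G" using assms(1) by blast
  then show ?case by simp
qed (use assms in \<open>auto simp: word_eval_append\<close>)

lemma presented_group_universal:
  assumes "range f \<subseteq> carrier G" "\<And>u v. (u, v) \<in> R \<Longrightarrow> word_eval G f u = word_eval G f v"
  shows "\<exists>h\<in>hom (presented_group R) G. \<forall>u. h (pres_class R u) = word_eval G f u"
proof -
  define h where "h A = word_eval G f (SOME u. A = pres_class R u)" for A
  have h: "h (pres_class R u) = word_eval G f u" for u
  proof -
    have "pres_class R u = pres_class R (SOME v. pres_class R u = pres_class R v)"
      by (rule someI) (rule HOL.refl)
    then show ?thesis
      using word_eval_pres_eq[OF assms] by (metis h_def pres_class_eq_iff)
  qed
  have "h \<in> hom (presented_group R) G"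
  proof (rule homI)
    fix A assume "A \<in> carrier (presented_group R)"
    then show "h A \<in> carrier G"
      using h word_eval_closed[OF assms(1)] by (auto simp: presented_group_def)
  next
    fix A B assume "A \<in> carrier (presented_group R)" "B \<in> carrier (presented_group R)"
    then obtain u v where "A = pres_class R u" "B = pres_class R v"
      by (auto simp: presented_group_def)
    then show "h (A \<otimes>\<^bsub>presented_group R\<^esub> B) = h A \<otimes> h B"
      by (simp add: mult_presented_group h word_eval_append[OF assms(1)])
  qed
  then show ?thesis using h by blast
qed

end

section \<open>Generalized quaternion 2-groups\<close>

datatype quat_gen = Gen_a | Gen_b

definition quat_relations :: "nat \<Rightarrow> (quat_gen word \<times> quat_gen word) set" where
  "quat_relations n =
     {(replicate (2 ^ (n - 2)) (Gen_a, True), [(Gen_b, True), (Gen_b, True)]),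
      (replicate (2 ^ (n - 1)) (Gen_a, True), []),
      ([(Gen_b, False), (Gen_a, True), (Gen_b, True)], [(Gen_a, False)])}"

definition generalized_quaternion_2_group :: "('a, 'b) monoid_scheme \<Rightarrow> bool" where
  "generalized_quaternion_2_group G \<longleftrightarrow>
     (\<exists>n\<ge>3. G \<cong> presented_group (quat_relations n))"

end

theory Submission
  imports Defs "HOL-Algebra.Group_Action" "HOL-Algebra.Sylow" "HOL-Number_Theory.Residues"
begin

text \<open>Let \<open>[H]\<close> be a breaking point. Comparing \<open>H\<close> with the subgroups of
  prime power order given by Sylow's theorem forces \<open>H\<close> and then \<open>G\<close> to be a \<open>p\<close>-group. The conjugates of
  \<open>H\<close> do not cover \<open>G\<close>, and an element outside all of them generates a cyclic group that
  contains a conjugate of \<open>H\<close>; so \<open>H\<close> is cyclic, and every subgroup of order \<open>p\<close> is conjugate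
  into \<open>H\<close>, hence equal to the central one: \<open>G\<close> has a unique subgroup of order \<open>p\<close>.

  In such a group abelian subgroups are cyclic. A maximal abelian normal subgroup \<open>A = \<langle>a\<rangle>\<close> is
  its own centralizer. If \<open>x \<notin> A\<close>, \<open>x\<^sup>p \<in> A\<close> and \<open>x a x\<inverse> = a\<^sup>r\<close>, then unless \<open>p = 2\<close> and
  \<open>a\<^sup>r = a\<inverse>\<close> some \<open>a\<^sup>i x\<close> has order \<open>p\<close>, which would put it into \<open>A\<close>. Hence every element outside \<open>A\<close>
  inverts \<open>A\<close>, so \<open>|G : A| = 2\<close> and \<open>G\<close> satisfies the quaternion relations.

  Conversely, in a generalized quaternion group \<open>b\<^sup>2\<close> lies in every nontrivial subgroup. That
  \<open>b\<^sup>2\<close> does not collapse to \<open>1\<close> in the presented group is seen in its action on \<open>\<complex>\<^sup>2\<close>.\<close>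

section \<open>Norms of units modulo prime powers\<close>

text \<open>The binomial expansion cut off after its linear term: every later term carries a factor
  \<open>p\<^sup>2\<close>.\<close>

lemma power_one_plus_mod_square:
  fixes p s :: int
  shows "p\<^sup>2 dvd (1 + p * s) ^ k - (1 + int k * p * s)"
proof (induction k)
  case (Suc k)
  have "(1 + p * s) ^ Suc k - (1 + int (Suc k) * p * s)
      = (1 + p * s) * ((1 + p * s) ^ k - (1 + int k * p * s)) + p\<^sup>2 * (int k * s\<^sup>2)"
    by (simp add: algebra_simps power2_eq_square)
  with Suc show ?case by (metis dvd_add dvd_mult dvd_triv_left)
qed simp

text \<open>The linear terms add up to \<open>p * s\<close> times
  \<open>0 + 1 + ... + (p - 1)\<close>, and for odd \<open>p\<close> that sum is itself a multiple
  of \<open>p\<close>. For \<open>p = 2\<close> it equals \<open>1\<close>, which is where the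
  quaternion case slips through.\<close>

lemma geometric_sum_mod_square:
  fixes s :: int and p :: nat
  assumes "odd p"
  shows "(int p)\<^sup>2 dvd (\<Sum>k<p. (1 + int p * s) ^ k) - int p"
proof -
  obtain c where c: "p = 2 * c + 1" using assms oddE by blast
  have sum: "(\<Sum>k<p. int k) = int p * int c"
    unfolding c by (induction c) (simp_all add: algebra_simps)
  have "(\<Sum>k<p. (1 + int p * s) ^ k) - int p = (\<Sum>k<p. (1 + int p * s) ^ k - (1 + int k * int p * s)) + (\<Sum>k<p. int k) * (int p * s)"
    by (simp add: sum_subtractf sum.distrib sum_distrib_right mult.assoc)
  also have "(\<Sum>k<p. int k) * (int p * s) = (int p)\<^sup>2 * (int c * s)"
    by (simp add: sum power2_eq_square)
  finally show ?thesis
    by (simp add: dvd_sum power_one_plus_mod_square)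
qed

text \<open>Both \<open>p * u\<close> and \<open>t\<close> contain the factor \<open>p\<close>, and
  \<open>u\<close> is a unit modulo \<open>p ^ m\<close>: with \<open>t = p * t'\<close> and
  \<open>x\<close> an inverse of \<open>u\<close>, take \<open>i = - (x * t')\<close>.\<close>

lemma linear_cong_solvable:
  fixes u t :: int and p m :: nat
  assumes "prime p" "coprime u (int p)" "int p dvd t"
  shows "\<exists>i. int p ^ m dvd i * (int p * u) + t"
proof -
  obtain t' where t': "t = int p * t'" using assms(3) by blast
  have "coprime u (int p ^ m)" using assms(2) by simp
  then obtain x where "[u * x = 1] (mod int p ^ m)" using cong_solve_coprime_int by blast
  then have "int p ^ m dvd u * x - 1" by (simp add: cong_iff_dvd_diff)
  then have "int p ^ m dvd (u * x - 1) * (- (int p * t'))" by (rule dvd_mult2)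
  also have "(u * x - 1) * (- (int p * t')) = (- (x * t')) * (int p * u) + t"
    by (simp add: t' algebra_simps)
  finally show ?thesis by blast
qed

text \<open>If \<open>x\<close> acts on \<open><a>\<close> as the power map \<open>r\<close> and
  \<open>x ^ p = a ^ t\<close>, then \<open>(a ^ i * x) ^ p = a ^ (i * N + t)\<close>, where
  \<open>N\<close> is the sum of the \<open>r ^ k\<close>; a solution \<open>i\<close> thus gives an
  element with trivial \<open>p\<close>-th power. Fermat's theorem yields
  \<open>r = 1 + p * s\<close>, and \<open>N\<close> is \<open>p\<close> times a unit unless
  \<open>p = 2\<close> and \<open>s\<close> is odd.\<close>

lemma power_dvd_shift_norm:
  fixes r :: nat and t :: int and p m :: nat
  assumes p: "prime p" and rp: "int p ^ m dvd int r ^ p - 1" and r1: "\<not> int p ^ m dvd int r - 1"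
    and t: "int p dvd t" "int p ^ m dvd t * (int r - 1)"
  shows "(\<exists>i. int p ^ m dvd i * (\<Sum>k<p. int r ^ k) + t) \<or> p = 2 \<and> int p ^ m dvd int r + 1"
proof -
  have m: "m > 0" using r1 by (cases m) auto
  have "int p dvd int r ^ p - 1" using rp m by (meson dvd_power dvd_trans)
  then have rp1: "[r ^ p = 1] (mod p)"
    by (metis cong_iff_dvd_diff cong_int_iff of_nat_1 of_nat_power)
  then have ndvd: "\<not> p dvd r"
    using p by (metis cong_dvd_iff dvd_power not_prime_unit prime_gt_0_nat dvd_trans)
  have "[r ^ p = r * 1] (mod p)"
    using cong_mult[OF cong_refl[of r p] fermat_theorem[OF p ndvd]] p
    by (metis power_Suc Suc_diff_1 prime_gt_0_nat)
  then have "[r = 1] (mod p)" using rp1 by (metis cong_sym cong_trans mult_1_right)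
  then have "int p dvd int r - 1" by (metis cong_iff_dvd_diff cong_int_iff of_nat_1)
  then obtain s where s: "int r - 1 = int p * s" by blast
  then have s: "int r = 1 + int p * s" by simp
  show ?thesis
  proof (cases "odd p")
    case True
    obtain w where "(\<Sum>k<p. int r ^ k) - int p = (int p)\<^sup>2 * w"
      using geometric_sum_mod_square[OF True, of s] unfolding s by blast
    then have S: "(\<Sum>k<p. int r ^ k) = int p * (1 + int p * w)"
      by (simp add: algebra_simps power2_eq_square)
    have "coprime (1 + int p * w) (int p)"
      by (metis coprime_1_left gcd_add_mult coprime_iff_gcd_eq_1 gcd.commute add.commute mult.commute)
    then show ?thesis using linear_cong_solvable[OF p _ t(1)] S by metis
  next
    case False
    then have p2: "p = 2" using p primes_dvd_imp_eq two_is_prime_nat by blast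
    have S: "(\<Sum>k<p. int r ^ k) = 1 + int r" by (simp add: p2 numeral_2_eq_2)
    show ?thesis
    proof (cases "even s")
      case True
      then have "odd (1 + s)" by simp
      then have "coprime (1 + s) (int p)" by (simp add: p2)
      moreover have "(\<Sum>k<p. int r ^ k) = int p * (1 + s)" using S s p2 by simp
      ultimately show ?thesis using linear_cong_solvable[OF p _ t(1)] by metis
    next
      case odd: False
      obtain l where l: "m = Suc l" using m by (cases m) auto
      \<comment> \<open>This is \<open>r\<^sup>2 - 1 = (r - 1) * (r + 1)\<close> with
        \<open>r - 1 = 2 * s\<close>. As \<open>s\<close> is odd, \<open>2 ^ l\<close> divides
        \<open>r + 1\<close>; the same cancellation is applied to \<open>t\<close> below.\<close>
      have "2 * 2 ^ l dvd 2 * (s * (int r + 1))"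
        using rp s unfolding l p2 by (simp add: power2_eq_square algebra_simps)
      then have "2 ^ l dvd s * (int r + 1)" by simp
      moreover have cop: "coprime (2 ^ l) s" using odd by simp
      ultimately have "2 ^ l dvd int r + 1" by (metis coprime_dvd_mult_right_iff)
      then obtain c where c: "int r + 1 = 2 ^ l * c" by blast
      have "2 * 2 ^ l dvd 2 * (s * t)"
        using t(2) s unfolding l p2 by (simp add: algebra_simps)
      then have "2 ^ l dvd s * t" by simp
      then have "2 ^ l dvd t" using cop by (metis coprime_dvd_mult_right_iff)
      then obtain d where d: "t = 2 ^ l * d" by blast
      have ev: "2 ^ m dvd 2 ^ l * e" if "even e" for e :: int
        using that by (auto simp: l)
      \<comment> \<open>Only parities matter now: \<open>c\<close> even makes \<open>r\<close> equal
        to \<open>-1\<close> modulo \<open>2 ^ m\<close>, \<open>d\<close> even allows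
        \<open>i = 0\<close>, and if both are odd then \<open>i = 1\<close> works.\<close>
      consider "even c" | "even d" | "even (c + d)" by fastforce
      then show ?thesis
      proof cases
        case 1
        then show ?thesis using ev c p2 by auto
      next
        case 2
        then have "int p ^ m dvd 0 * (\<Sum>k<p. int r ^ k) + t" using ev d p2 by simp
        then show ?thesis by blast
      next
        case 3
        then have "2 ^ m dvd 2 ^ l * (c + d)" by (rule ev)
        then have "int p ^ m dvd 1 * (\<Sum>k<p. int r ^ k) + t" using S c d p2
          by (simp add: algebra_simps)
        then show ?thesis by blast
      qed
    qed
  qed
qed

section \<open>Normal subgroups of p-groups\<close>

context group
begin

text \<open>Class equation inside \<open>N\<close>: a normal subgroup is a disjoint union of
  conjugacy classes, whose sizes are powers of \<open>p\<close>. If \<open>{\<one>}\<close> were the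
  only class of size one, \<open>card N\<close> would be \<open>1\<close> modulo \<open>p\<close>,
  although \<open>p\<close> divides it.\<close>

lemma p_group_normal_meets_center:
  assumes p: "prime p" and ord: "order G = p ^ n" and N: "N \<lhd> G" "N \<noteq> {\<one>}"
  shows "\<exists>z\<in>N. z \<noteq> \<one> \<and> (\<forall>g\<in>carrier G. g \<otimes> z = z \<otimes> g)"
proof (rule ccontr)
  assume no: "\<not> ?thesis"
  have fin: "finite (carrier G)"
    using ord p by (metis order_gt_0_iff_finite prime_gt_0_nat zero_less_power)
  have sub: "subgroup N G" using N(1) normal_imp_subgroup by blast
  have NG: "N \<subseteq> carrier G" and oneN: "\<one> \<in> N"
    using sub subgroup.subset subgroup.one_closed by auto
  let ?\<phi> = "\<lambda>g. \<lambda>h\<in>carrier G. g \<otimes> h \<otimes> inv g"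
  interpret act: group_action G "carrier G" ?\<phi> by (rule action_by_conjugation)
  define Orb where "Orb = (orbit G ?\<phi>) ` N"
  have orbit: "orbit G ?\<phi> x = {g \<otimes> x \<otimes> inv g | g. g \<in> carrier G}" if "x \<in> carrier G" for x
    using that by (auto simp: orbit_def)
  have OrbO: "Orb \<subseteq> orbits G (carrier G) ?\<phi>" using NG by (auto simp: Orb_def orbits_def)
  have un: "\<Union>Orb = N"
  proof
    show "\<Union>Orb \<subseteq> N"
      using NG normal_invE(2)[OF N(1)] by (auto simp: Orb_def orbit subset_iff)
    show "N \<subseteq> \<Union>Orb"
      using act.orbit_refl NG by (auto simp: Orb_def)
  qed
  have finN: "finite N" using fin NG finite_subset by blast
  have finO: "finite Orb" by (simp add: Orb_def finN)
  have one: "orbit G ?\<phi> \<one> = {\<one>}" using one_closed by (force simp: orbit)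
  have dvd: "p dvd card o'" if o: "o' \<in> Orb - {{\<one>}}" for o'
  proof -
    obtain x where x: "x \<in> N" "o' = orbit G ?\<phi> x" using o by (auto simp: Orb_def)
    have xG: "x \<in> carrier G" using x(1) NG by blast
    have xo: "x \<in> o'" using act.orbit_refl[OF xG] x(2) by simp
    note act.orbit_stabilizer_theorem[OF xG, folded x(2)]
    then have "card o' dvd p ^ n" unfolding ord by (rule dvdI[OF HOL.sym])
    then obtain i where i: "card o' = p ^ i" using p by (metis divides_primepow_nat)
    have "i \<noteq> 0"
    proof
      assume "i = 0"
      then obtain y where "o' = {y}" using i by (auto simp: card_1_singleton_iff)
      then have xx: "o' = {x}" using xo by simp
      then have "x \<noteq> \<one>" using o by blast
      moreover have "g \<otimes> x = x \<otimes> g" if "g \<in> carrier G" for g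
      proof -
        have "g \<otimes> x \<otimes> inv g \<in> o'" unfolding x(2) orbit[OF xG] using that by blast
        then have "g \<otimes> x \<otimes> inv g = x" using xx by simp
        then show ?thesis
          using that xG by (metis inv_solve_right m_closed)
      qed
      ultimately show False using no x by blast
    qed
    then show ?thesis using i by simp
  qed
  have "card N = (\<Sum>o'\<in>Orb. card o')"
  proof -
    have "card (\<Union>Orb) = sum card Orb"
    proof (rule card_Union_disjoint)
      show "pairwise disjnt Orb"
        using act.disjoint_union OrbO by (auto simp: pairwise_def disjnt_def)
      show "finite A" if "A \<in> Orb" for A
        using that un finN by (metis Union_upper finite_subset)
    qed
    then show ?thesis by (simp add: un)
  qed
  also have "\<dots> = 1 + (\<Sum>o'\<in>Orb - {{\<one>}}. card o')"
    using sum.remove[OF finO, of "{\<one>}" card] one oneN by (auto simp: Orb_def)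
  finally have eq: "card N = 1 + (\<Sum>o'\<in>Orb - {{\<one>}}. card o')" .
  have "p dvd (\<Sum>o'\<in>Orb - {{\<one>}}. card o')" using dvd by (rule dvd_sum)
  moreover have "p dvd card N"
  proof -
    have "card N dvd p ^ n" using lagrange[OF sub, unfolded ord] by (metis dvd_triv_right)
    then obtain i where i: "card N = p ^ i" using p by (metis divides_primepow_nat)
    have "card N \<noteq> 1" using N(2) oneN by (auto simp: card_1_singleton_iff)
    then have "i \<noteq> 0" using i by (metis power_0)
    then show ?thesis using i by simp
  qed
  ultimately have "p dvd 1" using eq by (metis dvd_add_left_iff)
  then show False using p by simp
qed

text \<open>The image of \<open>C\<close> in \<open>G Mod A\<close> is a nontrivial normal subgroup
  of a \<open>p\<close>-group, so it meets the center nontrivially; \<open>x\<close> is a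
  representative of such a central coset.\<close>

lemma p_group_normal_central_mod:
  assumes p: "prime p" and ord: "order G = p ^ n" and A: "A \<lhd> G" and C: "C \<lhd> G" and AC: "A \<subset> C"
  shows "\<exists>x\<in>C - A. \<forall>g\<in>carrier G. g \<otimes> x \<otimes> inv g \<in> A #> x"
proof -
  interpret A: normal A G by (rule A)
  interpret C: normal C G by (rule C)
  interpret Q: group "G Mod A" by (rule A.factorgroup_is_group)
  have fin: "finite (carrier G)"
    using ord p by (metis order_gt_0_iff_finite prime_gt_0_nat zero_less_power)
  have AG: "A \<subseteq> carrier G" and CG: "C \<subseteq> carrier G" by (simp_all add: A.subset C.subset)
  have "order (G Mod A) dvd p ^ n"
    using lagrange[OF A.subgroup_axioms] ord unfolding order_def FactGroup_def by (metis dvd_triv_left partial_object.select_convs(1))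
  then obtain k where k: "order (G Mod A) = p ^ k" using p by (metis divides_primepow_nat)
  have hom: "group_hom G (G Mod A) ((#>) A)"
    using A.r_coset_hom_Mod Q.group_axioms group_axioms by (simp add: group_hom_def group_hom_axioms_def)
  have N: "((#>) A ` C) \<lhd> (G Mod A)"
    by (rule C.surj_hom_normal_subgroup[OF hom]) (auto simp: FactGroup_def RCOSETS_def)
  obtain c where c: "c \<in> C" "c \<notin> A" using AC by blast
  have mem: "x \<in> A" if "A #> x = A" "x \<in> carrier G" for x
    using that A.subgroup_axioms rcos_self by blast
  have "(#>) A ` C \<noteq> {\<one>\<^bsub>G Mod A\<^esub>}"
    using c mem CG by (auto simp: FactGroup_def)
  from Q.p_group_normal_meets_center[OF p k N this] obtain x where
    x: "x \<in> C" "A #> x \<noteq> A" "\<And>g. g \<in> carrier G \<Longrightarrow> (A #> g) <#> (A #> x) = (A #> x) <#> (A #> g)"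
    by (auto simp: FactGroup_def RCOSETS_def)
  have xG: "x \<in> carrier G" using x CG by blast
  have "g \<otimes> x \<otimes> inv g \<in> A #> x" if g: "g \<in> carrier G" for g
  proof -
    have "A #> (g \<otimes> x) = A #> (x \<otimes> g)"
      using x(3)[OF g] g xG by (simp add: A.rcos_sum)
    then have "g \<otimes> x \<in> A #> (x \<otimes> g)"
      using rcos_self[OF _ A.subgroup_axioms] g xG by (metis m_closed)
    then obtain y where y: "y \<in> A" "g \<otimes> x = y \<otimes> (x \<otimes> g)" by (auto simp: r_coset_def)
    then have "g \<otimes> x \<otimes> inv g = y \<otimes> x"
      using g xG AG by (auto simp: m_assoc subset_iff)
    then show ?thesis using y by (auto simp: r_coset_def)
  qed
  moreover have "x \<notin> A" using x(2) AG A.subgroup_axioms A.rcos_const by blast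
  ultimately show ?thesis using x(1) by blast
qed

end

section \<open>p-groups with a unique subgroup of order p\<close>

text \<open>Conjugation by \<open>x\<close> is a homomorphism. The hypothesis is kept free of
  inverses because the commutation rules below arise in the shape \<open>x g = h x\<close>.\<close>

lemma (in group) conj_int_pow:
  assumes "g \<in> carrier G" "x \<in> carrier G" "x \<otimes> g = h \<otimes> x" "h \<in> carrier G"
  shows "x \<otimes> g [^] (i::int) = h [^] i \<otimes> x"
proof -
  have "h = x \<otimes> g \<otimes> inv x" using assms by (metis inv_solve_right m_closed)
  moreover have "(x \<otimes> g \<otimes> inv x) [^] i = x \<otimes> g [^] i \<otimes> inv x"
  proof -
    have "(\<lambda>y. x \<otimes> y \<otimes> inv x) \<in> hom G G"
      using assms by (intro homI) (auto simp: m_assoc inv_solve_left)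
    then interpret h: group_hom G G "\<lambda>y. x \<otimes> y \<otimes> inv x"
      by unfold_locales
    show ?thesis using h.hom_int_pow[OF assms(1), of i] by simp
  qed
  ultimately show ?thesis using assms by (simp add: m_assoc)
qed

lemma (in group) mult_inv_cancel:
  "\<lbrakk>x \<in> carrier G; y \<in> carrier G\<rbrakk> \<Longrightarrow> x \<otimes> (inv x \<otimes> y) = y"
  by (simp flip: m_assoc)

section \<open>Centralizers and commuting generators\<close>

lemma (in group) subgroup_centralizer:
  assumes S: "S \<subseteq> carrier G"
  shows "subgroup {x \<in> carrier G. \<forall>y\<in>S. x \<otimes> y = y \<otimes> x} G" (is "subgroup ?C G")
proof (rule subgroupI)
  have "\<one> \<in> ?C" using S by auto
  then show "?C \<noteq> {}" by blast
  show "inv x \<in> ?C" if x: "x \<in> ?C" for x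
  proof -
    have "inv x \<otimes> y = y \<otimes> inv x" if "y \<in> S" for y
    proof -
      have xy: "x \<in> carrier G" "y \<in> carrier G" "x \<otimes> y = y \<otimes> x" using x that S by auto
      then have "inv x \<otimes> (x \<otimes> y) \<otimes> inv x = inv x \<otimes> (y \<otimes> x) \<otimes> inv x" by simp
      then show ?thesis using xy(1,2) inv_solve_left inv_solve_right by (simp add: m_assoc) (simp flip: m_assoc)
    qed
    then show ?thesis using x by auto
  qed
  show "x \<otimes> z \<in> ?C" if x: "x \<in> ?C" and z: "z \<in> ?C" for x z
  proof -
    have "x \<otimes> z \<otimes> y = y \<otimes> (x \<otimes> z)" if "y \<in> S" for y
    proof -
      have c: "x \<in> carrier G" "z \<in> carrier G" "y \<in> carrier G" "x \<otimes> y = y \<otimes> x" "z \<otimes> y = y \<otimes> z"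
        using x z that S by auto
      have "x \<otimes> z \<otimes> y = x \<otimes> y \<otimes> z" using c m_assoc[of x z y] m_assoc[of x y z] by simp
      also have "\<dots> = y \<otimes> (x \<otimes> z)" using c m_assoc[of y x z] by simp
      finally show ?thesis .
    qed
    then show ?thesis using x z by auto
  qed
qed auto

text \<open>The centralizer argument is applied twice: \<open>B\<close> lies in its own centralizer,
  hence so does \<open>generate G B\<close>; then \<open>B\<close>, and with it
  \<open>generate G B\<close>, lies in the centralizer of \<open>generate G B\<close>.\<close>

lemma (in group) generate_commute:
  assumes B: "B \<subseteq> carrier G" and comm: "\<And>x y. \<lbrakk>x \<in> B; y \<in> B\<rbrakk> \<Longrightarrow> x \<otimes> y = y \<otimes> x"
    and u: "u \<in> generate G B" and v: "v \<in> generate G B"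
  shows "u \<otimes> v = v \<otimes> u"
proof -
  let ?C = "\<lambda>S. {x \<in> carrier G. \<forall>y\<in>S. x \<otimes> y = y \<otimes> x}"
  have gG: "generate G B \<subseteq> carrier G" by (rule generate_incl[OF B])
  have "B \<subseteq> ?C B" using B comm by auto
  then have "generate G B \<subseteq> ?C B" by (rule generate_subgroup_incl[OF _ subgroup_centralizer[OF B]])
  then have "B \<subseteq> ?C (generate G B)" using B by auto
  then have "generate G B \<subseteq> ?C (generate G B)"
    by (rule generate_subgroup_incl[OF _ subgroup_centralizer[OF gG]])
  then show ?thesis using u v by blast
qed

text \<open>The set \<open>Z\<close> plays the role of the unique subgroup of order \<open>p\<close>; only the properties
  assumed here are needed.\<close>

locale unique_order_p = group G for G (structure) +
  fixes p n :: nat and Z :: "'a set"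
  assumes prime_p: "prime p" and order_G: "order G = p ^ n"
    and card_Z: "card Z = p"
    and central_Z: "\<lbrakk>z \<in> Z; g \<in> carrier G\<rbrakk> \<Longrightarrow> g \<otimes> z = z \<otimes> g"
    and torsion_Z: "\<lbrakk>x \<in> carrier G; x [^] p = \<one>\<rbrakk> \<Longrightarrow> x \<in> Z"
    and not_cyclic: "\<not> cyclic_group G"
begin

lemma finite_G: "finite (carrier G)"
  using order_G prime_p by (metis order_gt_0_iff_finite prime_gt_0_nat zero_less_power)

lemma pow_order: "x \<in> carrier G \<Longrightarrow> x [^] (p ^ n) = \<one>"
  using pow_order_eq_1 order_G by metis

lemma ord_p_power:
  assumes "x \<in> carrier G" obtains k where "ord x = p ^ k"
  using ord_dvd_group_order[OF assms] order_G prime_p by (metis divides_primepow_nat)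

text \<open>The map \<open>x \<mapsto> x ^ p\<close> sends the \<open>p ^ (k + 1)\<close>-torsion of
  the abelian group \<open>A\<close> into its \<open>p ^ k\<close>-torsion, and each fibre lies in a
  translate of \<open>Z\<close>, so it has at most \<open>p\<close> elements.\<close>

lemma card_torsion_le:
  assumes A: "subgroup A G" and comm: "\<And>x y. \<lbrakk>x \<in> A; y \<in> A\<rbrakk> \<Longrightarrow> x \<otimes> y = y \<otimes> x"
  shows "card {x \<in> A. x [^] (p ^ k) = \<one>} \<le> p ^ k"
proof (induction k)
  have AG: "A \<subseteq> carrier G" using A subgroup.subset by blast
  case 0
  have "{x \<in> A. x [^] (p ^ 0) = \<one>} \<subseteq> {\<one>}" using AG by auto
  then have "card {x \<in> A. x [^] (p ^ 0) = \<one>} \<le> card {\<one>}" by (intro card_mono) auto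
  then show ?case by simp
next
  case (Suc k)
  have AG: "A \<subseteq> carrier G" using A subgroup.subset by blast
  have finA: "finite A" using AG finite_G finite_subset by blast
  have finZ: "finite Z" using card_Z prime_p by (metis card.infinite not_prime_0)
  let ?S = "\<lambda>k. {x \<in> A. x [^] (p ^ k) = \<one>}"
  let ?F = "\<lambda>y. {x \<in> A. x [^] p = y}"
  have sub: "?S (Suc k) \<subseteq> (\<Union>y\<in>?S k. ?F y)"
  proof
    fix x assume x: "x \<in> ?S (Suc k)"
    then have "(x [^] p) [^] (p ^ k) = \<one>" using AG by (auto simp: nat_pow_pow)
    moreover have "x [^] p \<in> A"
      using x subgroup_int_pow_closed[OF A, of x "int p"] by (simp add: int_pow_int)
    ultimately show "x \<in> (\<Union>y\<in>?S k. ?F y)" using x by blast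
  qed
  have fib: "card (?F y) \<le> p" for y
  proof (cases "?F y = {}")
    case False
    then obtain x0 where x0: "x0 \<in> A" "x0 [^] p = y" by blast
    have "?F y \<subseteq> (\<lambda>z. z \<otimes> x0) ` Z"
    proof
      fix x assume x: "x \<in> ?F y"
      let ?z = "x \<otimes> inv x0"
      have z: "x \<in> A" "inv x0 \<in> A" using x x0 A by (auto simp: subgroup.m_inv_closed)
      have "?z [^] p = x [^] p \<otimes> inv x0 [^] p"
        using pow_mult_distrib[OF comm[OF z]] z AG by blast
      also have "\<dots> = \<one>" using x x0 AG by (auto simp: nat_pow_inv)
      finally have "?z \<in> Z" using torsion_Z z AG by blast
      moreover have "x = ?z \<otimes> x0"
        using m_assoc[of x "inv x0" x0] z(1) x0(1) AG by (simp add: subset_iff)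
      ultimately show "x \<in> (\<lambda>z. z \<otimes> x0) ` Z" by blast
    qed
    then show ?thesis using surj_card_le[OF finZ] card_Z by blast
  next
    case True
    then show ?thesis by (simp only: card.empty)
  qed
  have finS: "finite (?S k)" using finA by simp
  have "card (?S (Suc k)) \<le> card (\<Union>y\<in>?S k. ?F y)"
    using sub finA by (intro card_mono) auto
  also have "\<dots> \<le> (\<Sum>y\<in>?S k. card (?F y))" by (rule card_UN_le[OF finS])
  also have "\<dots> \<le> card (?S k) * p"
    using sum_bounded_above[of "?S k" "\<lambda>y. card (?F y)" p] fib by simp
  also have "\<dots> \<le> p ^ k * p" using Suc by simp
  finally show ?case by (simp add: mult.commute)
qed

text \<open>Take \<open>a\<close> in \<open>A\<close> of maximal order \<open>p ^ k\<close>. All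
  orders are powers of \<open>p\<close>, so \<open>A\<close> consists of
  \<open>p ^ k\<close>-torsion and has at most \<open>p ^ k\<close> elements, which is the size of
  \<open><a>\<close>.\<close>

lemma abelian_subgroup_cyclic:
  assumes A: "subgroup A G" and comm: "\<And>x y. \<lbrakk>x \<in> A; y \<in> A\<rbrakk> \<Longrightarrow> x \<otimes> y = y \<otimes> x"
  shows "\<exists>a\<in>A. A = range (\<lambda>i::int. a [^] i)"
proof -
  have AG: "A \<subseteq> carrier G" using A subgroup.subset by blast
  have finA: "finite A" using AG finite_G finite_subset by blast
  have "\<one> \<in> A" using A subgroup.one_closed by blast
  then obtain a where a: "a \<in> A" "\<And>x. x \<in> A \<Longrightarrow> ord x \<le> ord a"
    using finA Max_in[of "ord ` A"] Max_ge[of "ord ` A"] by (metis (no_types, lifting) empty_iff finite_imageI image_iff)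
  obtain k where k: "ord a = p ^ k" using a AG ord_p_power by blast
  have "x [^] (p ^ k) = \<one>" if x: "x \<in> A" for x
  proof -
    obtain l where l: "ord x = p ^ l" using x AG ord_p_power by blast
    then have "l \<le> k" using a(2)[OF x] k prime_gt_1_nat[OF prime_p] by (metis power_le_imp_le_exp)
    then have "ord x dvd p ^ k" using l by (simp add: le_imp_power_dvd)
    then show ?thesis using x AG pow_eq_id by blast
  qed
  then have "A = {x \<in> A. x [^] (p ^ k) = \<one>}" by blast
  then have "card A \<le> p ^ k" using card_torsion_le[OF A comm] by metis
  moreover have "card (generate G {a}) = p ^ k"
    using generate_pow_card[of a] a AG k by auto
  moreover have "generate G {a} \<subseteq> A" using generate_subgroup_incl[OF _ A] a by blast
  ultimately have "generate G {a} = A" using card_seteq[OF finA] by metis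
  moreover have "generate G {a} = range (\<lambda>i::int. a [^] i)"
    using generate_pow[of a] a(1) AG by auto
  ultimately show ?thesis using a(1) by metis
qed

text \<open>Choose \<open>A\<close> abelian normal of largest size. Its centralizer \<open>C\<close>
  is normal; were it larger than \<open>A\<close>, some \<open>x\<close> in \<open>C - A\<close>
  would be central modulo \<open>A\<close>, and \<open>A\<close> together with \<open>x\<close>
  would generate a larger abelian normal subgroup.\<close>

lemma exists_self_centralizing:
  "\<exists>A. A \<lhd> G \<and> (\<forall>x\<in>A. \<forall>y\<in>A. x \<otimes> y = y \<otimes> x)
     \<and> (\<forall>x\<in>carrier G. (\<forall>y\<in>A. x \<otimes> y = y \<otimes> x) \<longrightarrow> x \<in> A)"
proof -
  define P where "P A \<longleftrightarrow> A \<lhd> G \<and> (\<forall>x\<in>A. \<forall>y\<in>A. x \<otimes> y = y \<otimes> x)" for A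
  have PG: "A \<subseteq> carrier G" if "P A" for A
    using that normal_imp_subgroup subgroup.subset unfolding P_def by blast
  have "P {\<one>}" unfolding P_def using one_is_normal by simp
  moreover have bound: "card A \<le> card (carrier G)" if "P A" for A
    using PG[OF that] card_mono[OF finite_G] by simp
  ultimately have "\<exists>A. P A \<and> (\<forall>B. P B \<longrightarrow> card B \<le> card A)"
    using ex_has_greatest_nat[where P = P and f = card and b = "Suc (card (carrier G))"]
    by (simp add: le_imp_less_Suc)
  then obtain A where A: "P A" and max: "\<And>B. P B \<Longrightarrow> card B \<le> card A" by auto
  have nA: "A \<lhd> G" and cA: "\<And>x y. \<lbrakk>x \<in> A; y \<in> A\<rbrakk> \<Longrightarrow> x \<otimes> y = y \<otimes> x"
    using A by (auto simp: P_def)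
  note AG = PG[OF A]
  define C where "C = {x \<in> carrier G. \<forall>y\<in>A. x \<otimes> y = y \<otimes> x}"
  have CG: "C \<subseteq> carrier G" by (auto simp: C_def)
  have AC: "A \<subseteq> C" using cA AG by (auto simp: C_def)
  have "C \<lhd> G"
  proof (rule normal_invI)
    show "subgroup C G" unfolding C_def by (rule subgroup_centralizer[OF AG])
  next
    fix g x assume g: "g \<in> carrier G" and x: "x \<in> C"
    have "g \<otimes> x \<otimes> inv g \<otimes> y = y \<otimes> (g \<otimes> x \<otimes> inv g)" if y: "y \<in> A" for y
    proof -
      let ?y = "inv g \<otimes> y \<otimes> g"
      have y': "?y \<in> A" using normal.inv_op_closed1[OF nA g y] .
      have yG: "y \<in> carrier G" "x \<in> carrier G" using y AG x CG by auto
      have "g \<otimes> (x \<otimes> ?y) \<otimes> inv g = g \<otimes> (?y \<otimes> x) \<otimes> inv g" using x y' by (simp add: C_def)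
      moreover have "g \<otimes> (x \<otimes> ?y) \<otimes> inv g = g \<otimes> x \<otimes> inv g \<otimes> y" using g yG by (simp add: m_assoc)
      moreover have "g \<otimes> (?y \<otimes> x) \<otimes> inv g = y \<otimes> (g \<otimes> x \<otimes> inv g)"
        using g yG by (simp add: m_assoc mult_inv_cancel)
      ultimately show ?thesis by simp
    qed
    then show "g \<otimes> x \<otimes> inv g \<in> C" using g x CG by (auto simp: C_def)
  qed
  have "C = A"
  proof (rule ccontr)
    assume "C \<noteq> A"
    then have "A \<subset> C" using AC by blast
    from p_group_normal_central_mod[OF prime_p order_G nA \<open>C \<lhd> G\<close> this]
    obtain x where x: "x \<in> C" "x \<notin> A" "\<And>g. g \<in> carrier G \<Longrightarrow> g \<otimes> x \<otimes> inv g \<in> A #> x" by blast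
    have xG: "x \<in> carrier G" using x CG by blast
    \<comment> \<open>\<open>B\<close> is only a generating set, but it is stable under conjugation
      because \<open>x\<close> is central modulo \<open>A\<close>, and its elements commute pairwise
      because \<open>x\<close> centralizes \<open>A\<close>. Both properties pass to
      \<open>generate G B\<close>.\<close>
    define B where "B = A \<union> (A #> x)"
    have BG: "B \<subseteq> carrier G" using AG xG by (auto simp: B_def r_coset_def)
    have "g \<otimes> b \<otimes> inv g \<in> B" if b: "b \<in> B" and g: "g \<in> carrier G" for b g
    proof (cases "b \<in> A")
      case True then show ?thesis using normal_invE(2)[OF nA g] by (simp add: B_def)
    next
      case False
      then obtain a where a: "a \<in> A" "b = a \<otimes> x" using b by (auto simp: B_def r_coset_def)
      obtain a' where a': "a' \<in> A" "g \<otimes> x \<otimes> inv g = a' \<otimes> x"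
        using x(3)[OF g] by (auto simp: r_coset_def)
      have aG: "a \<in> carrier G" "a' \<in> carrier G" using a a' AG by auto
      have "g \<otimes> b \<otimes> inv g = (g \<otimes> a \<otimes> inv g) \<otimes> (g \<otimes> x \<otimes> inv g)"
        using g aG xG a by (simp add: m_assoc inv_solve_left)
      also have "\<dots> = (g \<otimes> a \<otimes> inv g \<otimes> a') \<otimes> x" using g aG xG a' by (simp add: m_assoc)
      finally have "g \<otimes> b \<otimes> inv g = (g \<otimes> a \<otimes> inv g \<otimes> a') \<otimes> x" .
      moreover have "g \<otimes> a \<otimes> inv g \<otimes> a' \<in> A"
        using normal_invE[OF nA] a a' g by (simp add: subgroup.m_closed)
      ultimately show ?thesis by (auto simp: B_def r_coset_def)
    qed
    then have nB: "generate G B \<lhd> G" by (rule normal_generateI[OF BG])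
    have ax: "a \<otimes> x = x \<otimes> a" if "a \<in> A" for a using x(1) that by (simp add: C_def)
    have "b \<otimes> c = c \<otimes> b" if b: "b \<in> B" and c: "c \<in> B" for b c
    proof -
      have *: "a \<otimes> c = c \<otimes> a" if a: "a \<in> A" and c: "c \<in> B" for a c
      proof (cases "c \<in> A")
        case True then show ?thesis using cA a by blast
      next
        case False
        then obtain d where d: "d \<in> A" "c = d \<otimes> x" using c by (auto simp: B_def r_coset_def)
        have "a \<in> carrier G" "d \<in> carrier G" using a d AG by auto
        then show ?thesis using d(2) ax[OF a] cA[OF a d(1)] xG by (metis m_assoc)
      qed
      have **: "x \<otimes> c = c \<otimes> x"
      proof (cases "c \<in> A")
        case True then show ?thesis using ax by simp
      next
        case False
        then obtain d where d: "d \<in> A" "c = d \<otimes> x" using c by (auto simp: B_def r_coset_def)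
        then have "d \<in> carrier G" using AG by auto
        then show ?thesis using d(2) ax[OF d(1)] xG by (metis m_assoc)
      qed
      show ?thesis
      proof (cases "b \<in> A")
        case True then show ?thesis using * c by blast
      next
        case False
        then obtain d where d: "d \<in> A" "b = d \<otimes> x" using b by (auto simp: B_def r_coset_def)
        have "d \<in> carrier G" "c \<in> carrier G" using d c AG BG by auto
        then show ?thesis using d(2) *[OF d(1) c] ** xG by (metis m_assoc)
      qed
    qed
    then have "u \<otimes> v = v \<otimes> u" if "u \<in> generate G B" "v \<in> generate G B" for u v
      using generate_commute[OF BG] that by blast
    then have "P (generate G B)" using nB by (simp add: P_def)
    then have "card (generate G B) \<le> card A" by (rule max)
    moreover have "A \<subset> generate G B"
    proof -
      have "x \<in> B" using xG normal_imp_subgroup[OF nA] subgroup.one_closed unfolding B_def r_coset_def by force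
      then show ?thesis using x(2) generate.incl[of _ B G] B_def by blast
    qed
    moreover have "finite (generate G B)"
      using finite_G generate_incl[OF BG] finite_subset by blast
    ultimately show False by (metis leD psubset_card_mono)
  qed
  then show ?thesis using nA cA by (auto simp: C_def)
qed

end

section \<open>Power formulas when \<open>x\<close> acts on \<open><a>\<close> as a power
  map\<close>

lemma (in group) int_pow_twisted_pow:
  assumes a: "a \<in> carrier G" and x: "x \<in> carrier G" and tw: "x \<otimes> a = a [^] (r::int) \<otimes> x"
  shows "x [^] (k::nat) \<otimes> a [^] (i::int) = a [^] (i * r ^ k) \<otimes> x [^] k"
proof (induction k arbitrary: i)
  case (Suc k)
  have "x \<otimes> a [^] i = a [^] (i * r) \<otimes> x"
    using conj_int_pow[OF a x tw, of i] a by (simp add: int_pow_pow mult.commute)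
  then have "x [^] Suc k \<otimes> a [^] i = x [^] k \<otimes> a [^] (i * r) \<otimes> x"
    using a x by (simp add: m_assoc)
  also have "\<dots> = a [^] (i * r * r ^ k) \<otimes> x [^] Suc k"
    using a x by (simp add: Suc.IH m_assoc)
  finally show ?case by (simp add: mult.assoc)
qed (use a in simp)

text \<open>Moving every \<open>a ^ i\<close> to the left past \<open>j\<close> factors
  \<open>x\<close> multiplies its exponent by \<open>r ^ j\<close>; the collected exponent is
  \<open>i\<close> times the norm sum treated in \<open>power_dvd_shift_norm\<close>.\<close>

lemma (in group) twisted_product_pow:
  assumes a: "a \<in> carrier G" and x: "x \<in> carrier G" and tw: "x \<otimes> a = a [^] (r::int) \<otimes> x"
  shows "(a [^] (i::int) \<otimes> x) [^] (k::nat) = a [^] (i * (\<Sum>j<k. r ^ j)) \<otimes> x [^] k"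
proof (induction k)
  case (Suc k)
  let ?S = "\<Sum>j<k. r ^ j"
  have "(a [^] i \<otimes> x) [^] Suc k = a [^] (i * ?S) \<otimes> (x [^] k \<otimes> a [^] i) \<otimes> x"
    using a x by (simp add: Suc.IH m_assoc)
  also have "\<dots> = a [^] (i * ?S) \<otimes> a [^] (i * r ^ k) \<otimes> (x [^] k \<otimes> x)"
    using a x by (simp add: int_pow_twisted_pow[OF a x tw] m_assoc)
  also have "\<dots> = a [^] (i * (\<Sum>j<Suc k. r ^ j)) \<otimes> x [^] Suc k"
    using a by (simp add: int_pow_mult distrib_left)
  finally show ?case .
qed (use a in simp)

section \<open>Structure of the group around a self-centralizing cyclic normal subgroup\<close>

context unique_order_p
begin

theorem quaternion_generators:
  obtains a x m where "a \<in> carrier G" "x \<in> carrier G" "2 \<le> m" "order G = 2 ^ (m + 1)"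
    "a [^] (2 ^ (m - 1) :: nat) = x \<otimes> x" "a [^] (2 ^ m :: nat) = \<one>" "inv x \<otimes> a \<otimes> x = inv a"
    "carrier G = range (\<lambda>i::int. a [^] i) \<union> range (\<lambda>i::int. a [^] i \<otimes> x)"
proof -
  obtain A where nA: "A \<lhd> G" and cA: "\<And>x y. \<lbrakk>x \<in> A; y \<in> A\<rbrakk> \<Longrightarrow> x \<otimes> y = y \<otimes> x"
    and self: "\<And>x. \<lbrakk>x \<in> carrier G; \<And>y. y \<in> A \<Longrightarrow> x \<otimes> y = y \<otimes> x\<rbrakk> \<Longrightarrow> x \<in> A"
    using exists_self_centralizing by blast
  have subA: "subgroup A G" using nA normal_imp_subgroup by blast
  have AG: "A \<subseteq> carrier G" using subA subgroup.subset by blast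
  obtain a where aA: "a \<in> A" and A: "A = range (\<lambda>i::int. a [^] i)"
    using abelian_subgroup_cyclic[OF subA] cA by blast
  have a: "a \<in> carrier G" using aA AG by blast
  obtain m where m: "ord a = p ^ m" using ord_p_power[OF a] .
  have pow_eq: "a [^] i = a [^] j \<longleftrightarrow> int p ^ m dvd j - i" for i j :: int
    using int_pow_eq[OF a, of i j] m by simp
  have a1: "a [^] (1::int) = a" "a [^] (-1::int) = inv a"
    using a int_pow_neg[of a 1] by simp_all
  have cent: "x \<in> A" if x: "x \<in> carrier G" "x \<otimes> a = a \<otimes> x" for x
  proof (rule self[OF x(1)])
    fix y assume "y \<in> A"
    then obtain i :: int where "y = a [^] i" using A by blast
    then show "x \<otimes> y = y \<otimes> x" using conj_int_pow[OF a x a] by simp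
  qed
  have tors: "y \<in> A" if "y \<in> carrier G" "y [^] p = \<one>" for y
    using cent[OF that(1)] central_Z[OF torsion_Z[OF that] a] by simp
  have "A \<noteq> carrier G" using not_cyclic a A cyclic_group by blast
  then obtain g0 where g0: "g0 \<in> carrier G" "g0 \<notin> A" using AG by blast
  \<comment> \<open>The exponent is reduced modulo the order of \<open>a\<close> to make it a
    natural number, as the use of Fermat's theorem in \<open>power_dvd_shift_norm\<close>
    requires.\<close>
  have twist: "\<exists>r::nat. g \<otimes> a = a [^] int r \<otimes> g" if g: "g \<in> carrier G" for g
  proof -
    obtain i :: int where i: "g \<otimes> a \<otimes> inv g = a [^] i"
      using normal_invE(2)[OF nA g aA] A by blast
    have "p ^ m > 0" using prime_gt_0_nat[OF prime_p] by simp
    then have "int (nat (i mod int p ^ m)) = i mod int p ^ m" by simp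
    then have "a [^] int (nat (i mod int p ^ m)) = a [^] i"
      unfolding pow_eq by (simp add: minus_mod_eq_mult_div)
    then have "g \<otimes> a \<otimes> inv g = a [^] int (nat (i mod int p ^ m))" using i by simp
    moreover have "g \<otimes> a = g \<otimes> a \<otimes> inv g \<otimes> g" using g a by (simp add: m_assoc)
    ultimately show ?thesis by metis
  qed
  have key: "p = 2 \<and> x \<otimes> a = inv a \<otimes> x"
    if x: "x \<in> carrier G" "x \<notin> A" and xp: "x [^] p \<in> A" for x
  proof -
    obtain r :: nat where r: "x \<otimes> a = a [^] int r \<otimes> x" using twist[OF x(1)] by blast
    obtain t :: int where t: "x [^] p = a [^] t" using xp A by blast
    note tw = int_pow_twisted_pow[OF a x(1) r]
    have ncop: "\<not> int p ^ m dvd int r - 1"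
    proof
      assume "int p ^ m dvd int r - 1"
      then have "a [^] (1::int) = a [^] int r" by (simp only: pow_eq)
      then show False using cent[OF x(1)] x(2) r a1 by simp
    qed
    \<comment> \<open>\<open>x ^ p\<close> lies in the abelian group \<open>A\<close> and so
      commutes with \<open>a\<close>; this gives \<open>r ^ p = 1\<close> modulo
      \<open>p ^ m\<close>. Next, \<open>x\<close> commutes with its own power \<open>a ^ t\<close>,
      which bounds \<open>t * (r - 1)\<close>.\<close>
    have "a [^] (int r ^ p) \<otimes> x [^] p = a [^] (1::int) \<otimes> x [^] p"
      using tw[of p 1] cA[OF xp aA] a1 by simp
    then have "a [^] (1::int) = a [^] (int r ^ p)" using a x by simp
    then have rp: "int p ^ m dvd int r ^ p - 1" by (simp only: pow_eq)
    have "a [^] (t * int r) \<otimes> x = x [^] (1::nat) \<otimes> a [^] t" using tw[of 1 t] x by simp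
    also have "\<dots> = a [^] t \<otimes> x"
      using t x(1) nat_pow_Suc2[of x p] nat_pow_Suc[of x p] by simp
    finally have "a [^] t = a [^] (t * int r)" using a x by simp
    then have tr: "int p ^ m dvd t * (int r - 1)" by (simp add: pow_eq right_diff_distrib)
    have "int p dvd t"
    proof (rule ccontr)
      assume "\<not> int p dvd t"
      then have "coprime (int p) t" using prime_p by (simp add: prime_imp_coprime)
      then have "coprime (int p ^ m) t" by simp
      then show False using tr ncop coprime_dvd_mult_right_iff by blast
    qed
    from power_dvd_shift_norm[OF prime_p rp ncop this tr] show ?thesis
    proof
      assume "\<exists>i. int p ^ m dvd i * (\<Sum>k<p. int r ^ k) + t"
      then obtain i where i: "int p ^ m dvd i * (\<Sum>k<p. int r ^ k) + t" by blast
      \<comment> \<open>The shifted element has trivial \<open>p\<close>-th power, hence lies in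
        \<open>A\<close>; cancelling \<open>a ^ i\<close> would put \<open>x\<close> into
        \<open>A\<close> as well.\<close>
      have "(a [^] i \<otimes> x) [^] p = a [^] (i * (\<Sum>k<p. int r ^ k) + t)"
        using twisted_product_pow[OF a x(1) r, of i p] t a by (simp add: int_pow_mult)
      also have "\<dots> = a [^] (0::int)" using i unfolding pow_eq by (simp only: diff_0 dvd_minus_iff)
      finally have "a [^] i \<otimes> x \<in> A" using tors a x by simp
      moreover have "a [^] i \<in> A" using A by blast
      ultimately have "inv (a [^] i) \<otimes> (a [^] i \<otimes> x) \<in> A"
        using subA subgroup.m_closed subgroup.m_inv_closed by metis
      moreover have "inv (a [^] i) \<otimes> (a [^] i \<otimes> x) = x" using a x by (simp flip: m_assoc)
      ultimately show ?thesis using x by simp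
    next
      assume *: "p = 2 \<and> int p ^ m dvd int r + 1"
      then have "a [^] (-1::int) = a [^] int r" unfolding pow_eq diff_minus_eq_add by blast
      then show ?thesis using * r a1 by simp
    qed
  qed
  have inv_ne: "a \<noteq> inv a" if "x \<in> carrier G" "x \<notin> A" "x \<otimes> a = inv a \<otimes> x" for x
    using cent that by metis
  have small: "2 \<le> m" if "a \<noteq> inv a" "p = 2"
  proof (rule ccontr)
    assume "\<not> 2 \<le> m"
    then have "m = 0 \<or> m = 1" by linarith
    then have "int p ^ m dvd -1 - 1" using that by auto
    then have "a [^] (1::int) = a [^] (-1::int)" unfolding pow_eq .
    then show False using that a1 by simp
  qed
  have out: "p = 2 \<and> g \<otimes> a = inv a \<otimes> g \<and> g \<otimes> g \<in> A" if g: "g \<in> carrier G" "g \<notin> A" for g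
  proof -
    have ex: "g [^] (p ^ n) \<in> A" using pow_order g subA subgroup.one_closed by metis
    \<comment> \<open>The last iterated \<open>p\<close>-th power of \<open>g\<close> still outside
      \<open>A\<close> satisfies \<open>key\<close>, so it inverts \<open>a\<close>. It remains to
      see that this power is \<open>g\<close> itself.\<close>
    define k where "k = (LEAST k. g [^] (p ^ k) \<in> A)"
    have k: "g [^] (p ^ k) \<in> A" unfolding k_def by (rule LeastI[of _ n]) (rule ex)
    have less: "g [^] (p ^ l) \<notin> A" if "l < k" for l
      using that not_less_Least unfolding k_def by blast
    have "k \<noteq> 0" using k g by (metis nat_pow_eone power_0)
    then obtain l where l: "k = Suc l" by (cases k) auto
    let ?x = "g [^] (p ^ l)"
    have x: "?x \<in> carrier G" "?x \<notin> A" using g less l by auto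
    have "?x [^] p \<in> A" using k g l by (simp add: nat_pow_pow mult.commute)
    from key[OF x this] have p2: "p = 2" and inv: "?x \<otimes> a = inv a \<otimes> ?x" by auto
    have m2: "2 \<le> m" using small inv_ne x inv p2 by blast
    show ?thesis
    proof (cases l)
      case 0
      then show ?thesis using p2 inv g k l by (simp add: numeral_2_eq_2)
    next
      case (Suc j)
      let ?y = "g [^] (p ^ j)"
      have y: "?y \<in> carrier G" using g by simp
      obtain r :: nat where r: "?y \<otimes> a = a [^] int r \<otimes> ?y" using twist[OF y] by blast
      have "?y [^] (2::nat) = ?x" using g Suc p2 by (simp add: nat_pow_pow mult.commute)
      then have "?x \<otimes> a = a [^] (int r ^ 2) \<otimes> ?x"
        using int_pow_twisted_pow[OF a y r, of 2 1] a1 by simp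
      then have "a [^] (-1::int) = a [^] (int r ^ 2)" using inv a1 a x by simp
      then have "2 ^ m dvd int r ^ 2 + 1" using p2 by (simp add: pow_eq)
      moreover have "(2::int) ^ 2 dvd 2 ^ m" using m2 by (rule le_imp_power_dvd)
      ultimately have four: "4 dvd int r ^ 2 + 1" by (simp add: dvd_trans)
      \<comment> \<open>Otherwise the inverting element is the square of \<open>?y\<close>, so
        \<open>r\<^sup>2 = -1\<close> modulo \<open>2 ^ m\<close>. Since \<open>m\<close> is at
        least \<open>2\<close>, this would make \<open>-1\<close> a square modulo
        \<open>4\<close>.\<close>
      have "int r mod 4 \<in> {0, 1, 2, 3}" by auto
      then have "((int r mod 4)\<^sup>2 + 1) mod 4 \<noteq> 0" by auto
      moreover have "((int r mod 4)\<^sup>2 + 1) mod 4 = (int r ^ 2 + 1) mod 4"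
        by (metis mod_add_left_eq power_mod)
      ultimately have False using four by (simp only: dvd_eq_mod_eq_0)
      then show ?thesis ..
    qed
  qed
  have p2: "p = 2" using out[OF g0] by blast
  have m2: "2 \<le> m" using small inv_ne g0 out p2 by blast
  have flip: "g \<otimes> inv a = a \<otimes> g" if g: "g \<in> carrier G" "g \<notin> A" for g
    using conj_int_pow[OF a g(1), of "inv a" "-1"] out[OF g] a a1 int_pow_neg[of "inv a" 1] by simp
  \<comment> \<open>Two elements that invert \<open>a\<close> have a product that centralizes it, so
    \<open>A\<close> has index two.\<close>
  have prod: "g \<otimes> h \<in> A" if g: "g \<in> carrier G" "g \<notin> A" and h: "h \<in> carrier G" "h \<notin> A" for g h
  proof (rule cent)
    have "g \<otimes> h \<otimes> a = g \<otimes> inv a \<otimes> h" using out[OF h] g h a by (simp add: m_assoc)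
    also have "\<dots> = a \<otimes> (g \<otimes> h)" using flip[OF g] g h a by (simp add: m_assoc)
    finally show "g \<otimes> h \<otimes> a = a \<otimes> (g \<otimes> h)" .
  qed (use g h in simp)
  define x where "x = g0"
  have x: "x \<in> carrier G" "x \<notin> A" using g0 by (auto simp: x_def)
  have ix: "inv x \<notin> A" using x subgroup.m_inv_closed[OF subA] by (metis inv_inv)
  have carr: "carrier G = A \<union> (A #> x)"
  proof
    show "carrier G \<subseteq> A \<union> (A #> x)"
    proof
      fix g assume g: "g \<in> carrier G"
      show "g \<in> A \<union> (A #> x)"
      proof (cases "g \<in> A")
        case False
        have "g = (g \<otimes> inv x) \<otimes> x" using g x by (simp add: m_assoc)
        then show ?thesis using prod[OF g False _ ix] x by (auto simp: r_coset_def)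
      qed simp
    qed
    show "A \<union> (A #> x) \<subseteq> carrier G" using AG x r_coset_subset_G by auto
  qed
  have finA: "finite A" using AG finite_G finite_subset by blast
  have "A \<inter> (A #> x) = {}"
  proof -
    have "x \<in> A" if u: "u \<in> A" "v \<in> A" "u = v \<otimes> x" for u v
    proof -
      have "inv v \<otimes> u = x" using u AG x by (auto simp: subset_iff simp flip: m_assoc)
      then show ?thesis using u subA subgroup.m_closed subgroup.m_inv_closed by metis
    qed
    then show ?thesis using x by (auto simp: r_coset_def)
  qed
  moreover have "card (A #> x) = card A"
    using card_cosets_equal[OF rcosetsI[OF AG x(1)] AG] bij_betw_same_card by metis
  moreover have "card A = 2 ^ m"
    using generate_pow_card[OF a] generate_pow[OF a] m p2 A by (simp add: full_SetCompr_eq)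
  ultimately have ord: "order G = 2 ^ (m + 1)"
    using card_Un_disjoint[OF finA, of "A #> x"] finA carr finite_G unfolding order_def
    by (metis finite_Un mult_2 power_add power_one_right mult.commute)
  \<comment> \<open>\<open>x\<close> both commutes with its square \<open>a ^ t\<close> and inverts
    it, so \<open>2 * t\<close> vanishes modulo \<open>2 ^ m\<close>. The case \<open>t = 0\<close>
    modulo \<open>2 ^ m\<close> is excluded since \<open>x\<close> would then be torsion and lie in
    \<open>A\<close>; only the involution of \<open><a>\<close> is left.\<close>
  obtain t :: int where t: "x \<otimes> x = a [^] t" using out[OF x] A by blast
  have "x \<otimes> a [^] t = a [^] (- t) \<otimes> x"
    using int_pow_twisted_pow[OF a x(1), of "-1" 1 t] out[OF x] a1 x by simp
  moreover have "x \<otimes> a [^] t = a [^] t \<otimes> x" using t x by (metis m_assoc)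
  ultimately have "a [^] t = a [^] (- t)" using a x by simp
  then have "2 ^ m dvd - t - t" unfolding pow_eq p2 by simp
  then have d: "2 ^ m dvd 2 * t" by (metis dvd_minus_iff mult_2 minus_add_distrib uminus_add_conv_diff)
  obtain l where l: "m = Suc l" using m2 by (cases m) auto
  have "2 ^ l dvd t" using d l by simp
  then obtain s where s: "t = 2 ^ l * s" by blast
  have "odd s"
  proof
    assume "even s"
    then have "2 ^ m dvd t" using s l by auto
    then have "a [^] (0::int) = a [^] t" unfolding pow_eq p2 by simp
    then have "x \<otimes> x = \<one>" using t by simp
    then have "x [^] p = \<one>" using x p2 by (simp add: numeral_2_eq_2)
    then show False using tors x by blast
  qed
  then have "2 ^ m dvd 2 ^ l * (s - 1)" using l by auto
  then have "a [^] (2 ^ l :: int) = a [^] t" unfolding pow_eq p2 s by (simp add: right_diff_distrib)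
  then have rel1: "a [^] (2 ^ (m - 1) :: nat) = x \<otimes> x"
    using t l int_pow_int[of G a "2 ^ l"] by simp
  have rel2: "a [^] (2 ^ m :: nat) = \<one>" using pow_ord_eq_1[OF a] m p2 by simp
  have rel3: "inv x \<otimes> a \<otimes> x = inv a"
    using flip[OF x] x a by (metis inv_closed inv_solve_left m_assoc m_closed)
  have "carrier G = range (\<lambda>i::int. a [^] i) \<union> range (\<lambda>i::int. a [^] i \<otimes> x)"
    using carr A by (auto simp: r_coset_def)
  from that[OF a x(1) m2 ord rel1 rel2 rel3 this] show thesis .
qed

end

section \<open>Groups satisfying the quaternion relations\<close>

text \<open>This lets results about \<open>word_eval\<close> in an arbitrary group be applied to the
  presented group itself, with its canonical generators.\<close>

lemma word_eval_presented_group: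
  "word_eval (presented_group R) (\<lambda>g. pres_class R [(g, True)]) u = pres_class R u"
proof (induction u)
  case Nil show ?case by (simp add: presented_group_def)
next
  case (Cons l u)
  interpret P: group "presented_group R" by (rule group_presented_group)
  obtain g e where l: "l = (g, e)" by force
  have mem: "pres_class R w \<in> carrier (presented_group R)" for w by (simp add: presented_group_def)
  have "pres_class R [(g, False)] \<otimes>\<^bsub>presented_group R\<^esub> pres_class R [(g, True)] = \<one>\<^bsub>presented_group R\<^esub>"
    using pres_eq.cancel[of R g False]
    by (simp add: mult_presented_group) (simp add: presented_group_def pres_class_eq_iff)
  then have "inv\<^bsub>presented_group R\<^esub> pres_class R [(g, True)] = pres_class R [(g, False)]"
    by (rule P.inv_equality) (rule mem)+
  then show ?case by (cases e) (simp_all add: l Cons.IH mult_presented_group)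
qed

lemma (in group_hom) hom_word_eval:
  assumes "range f \<subseteq> carrier G"
  shows "h (word_eval G f u) = word_eval H (h \<circ> f) u"
proof (induction u)
  case (Cons l u)
  have "f (fst l) \<in> carrier G" using assms by blast
  then show ?case using Cons G.word_eval_closed[OF assms] by simp
qed simp

lemma (in group) word_eval_replicate:
  "f g \<in> carrier G \<Longrightarrow> word_eval G f (replicate k (g, True)) = f g [^] k"
  by (induction k) (simp_all add: nat_pow_Suc2[symmetric])

text \<open>The elements need not generate \<open>G\<close> and may satisfy further relations, so
  the notion covers \<open>G\<close>, the presented group and its concrete action alike.\<close>

definition quaternion_pair :: "('a, 'b) monoid_scheme \<Rightarrow> nat \<Rightarrow> 'a \<Rightarrow> 'a \<Rightarrow> bool" where
  "quaternion_pair G n a b \<longleftrightarrow> a \<in> carrier G \<and> b \<in> carrier G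
     \<and> a [^]\<^bsub>G\<^esub> (2 ^ (n - 2) :: nat) = b \<otimes>\<^bsub>G\<^esub> b \<and> a [^]\<^bsub>G\<^esub> (2 ^ (n - 1) :: nat) = \<one>\<^bsub>G\<^esub>
     \<and> inv\<^bsub>G\<^esub> b \<otimes>\<^bsub>G\<^esub> a \<otimes>\<^bsub>G\<^esub> b = inv\<^bsub>G\<^esub> a"

lemma range_quat_gen: "range f \<subseteq> C \<longleftrightarrow> f Gen_a \<in> C \<and> f Gen_b \<in> C"
  by (auto simp: image_subset_iff) (metis quat_gen.exhaust)

lemma (in group) quaternion_pair_iff:
  assumes "f Gen_a \<in> carrier G" "f Gen_b \<in> carrier G"
  shows "quaternion_pair G n (f Gen_a) (f Gen_b)
    \<longleftrightarrow> (\<forall>(u, v)\<in>quat_relations n. word_eval G f u = word_eval G f v)"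
  using assms by (simp add: quaternion_pair_def quat_relations_def word_eval_replicate m_assoc)

lemma quaternion_pair_presented_group:
  "quaternion_pair (presented_group (quat_relations n)) n
     (pres_class (quat_relations n) [(Gen_a, True)]) (pres_class (quat_relations n) [(Gen_b, True)])"
proof -
  interpret P: group "presented_group (quat_relations n)" by (rule group_presented_group)
  have "pres_class (quat_relations n) u \<in> carrier (presented_group (quat_relations n))" for u
    by (simp add: presented_group_def)
  then show ?thesis
    by (subst P.quaternion_pair_iff[of "\<lambda>g. pres_class (quat_relations n) [(g, True)]"])
      (auto simp: word_eval_presented_group pres_class_eq_iff pres_eq.rel)
qed

section \<open>Normal forms and orders under the quaternion relations\<close>

context group
begin

lemma quaternion_pair_twist:
  assumes "quaternion_pair G n a b"
  shows "b \<otimes> a [^] (i::int) = a [^] (- i) \<otimes> b"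
proof -
  have a: "a \<in> carrier G" and b: "b \<in> carrier G" and r: "inv b \<otimes> a \<otimes> b = inv a"
    using assms by (auto simp: quaternion_pair_def)
  have "b \<otimes> inv a = a \<otimes> b" unfolding r[symmetric] using a b by (simp add: m_assoc mult_inv_cancel)
  from conj_int_pow[OF _ b this a, of "- i"] show ?thesis using a by (simp add: int_pow_neg int_pow_inv)
qed

text \<open>Moving \<open>b\<close> past the second \<open>a ^ i\<close> inverts it, and the two
  powers of \<open>a\<close> cancel.\<close>

lemma quaternion_pair_square:
  assumes "quaternion_pair G n a b"
  shows "(a [^] (i::int) \<otimes> b) \<otimes> (a [^] i \<otimes> b) = b \<otimes> b"
proof -
  have a: "a \<in> carrier G" and b: "b \<in> carrier G"
    using assms by (auto simp: quaternion_pair_def)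
  have "(a [^] i \<otimes> b) \<otimes> (a [^] i \<otimes> b) = a [^] i \<otimes> (b \<otimes> a [^] i) \<otimes> b"
    using a b by (simp add: m_assoc)
  also have "\<dots> = a [^] i \<otimes> a [^] (- i) \<otimes> (b \<otimes> b)"
    unfolding quaternion_pair_twist[OF assms] using a b by (simp add: m_assoc)
  also have "a [^] i \<otimes> a [^] (- i) = \<one>" using a by (simp flip: int_pow_mult)
  finally show ?thesis using b by simp
qed

text \<open>The normal forms \<open>a ^ i\<close> and \<open>a ^ i * b\<close> are stable under left
  multiplication by powers of \<open>a\<close> and by \<open>b\<close>, hence by every
  letter.\<close>

lemma quaternion_pair_word_eval:
  assumes pair: "quaternion_pair G n (f Gen_a) (f Gen_b)"
  shows "word_eval G f u \<in> range (\<lambda>i::int. f Gen_a [^] i) \<union> range (\<lambda>i::int. f Gen_a [^] i \<otimes> f Gen_b)"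
    (is "_ \<in> ?S")
proof (induction u)
  case Nil
  have "\<one> = f Gen_a [^] (0::int)" by simp
  then show ?case by (metis UnI1 rangeI word_eval.simps(1))
next
  case (Cons l u)
  let ?a = "f Gen_a" and ?b = "f Gen_b"
  have a: "?a \<in> carrier G" and b: "?b \<in> carrier G" and bb: "?b \<otimes> ?b = ?a [^] (2 ^ (n - 2) :: int)"
    using pair int_pow_int[of G ?a "2 ^ (n - 2)"] by (auto simp: quaternion_pair_def)
  have SG: "?S \<subseteq> carrier G" using a b by auto
  have pa: "?a [^] (k::int) \<otimes> w \<in> ?S" if w: "w \<in> ?S" for k w
    using w
  proof
    assume "w \<in> range (\<lambda>i::int. ?a [^] i)"
    then obtain i :: int where "w = ?a [^] i" by blast
    then have "?a [^] k \<otimes> w = ?a [^] (k + i)" using a by (simp add: int_pow_mult)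
    then show ?thesis by blast
  next
    assume "w \<in> range (\<lambda>i::int. ?a [^] i \<otimes> ?b)"
    then obtain i :: int where "w = ?a [^] i \<otimes> ?b" by blast
    then have "?a [^] k \<otimes> w = ?a [^] (k + i) \<otimes> ?b" using a b by (simp add: int_pow_mult m_assoc)
    then show ?thesis by blast
  qed
  have pb: "?b \<otimes> w \<in> ?S" if w: "w \<in> ?S" for w
    using w
  proof
    assume "w \<in> range (\<lambda>i::int. ?a [^] i)"
    then show ?thesis using quaternion_pair_twist[OF pair] by auto
  next
    assume "w \<in> range (\<lambda>i::int. ?a [^] i \<otimes> ?b)"
    then obtain i :: int where i: "w = ?a [^] i \<otimes> ?b" by blast
    have "?b \<otimes> w = (?b \<otimes> ?a [^] i) \<otimes> ?b" using i a b by (simp add: m_assoc)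
    also have "\<dots> = ?a [^] (- i) \<otimes> (?b \<otimes> ?b)"
      unfolding quaternion_pair_twist[OF pair] using a b by (simp add: m_assoc)
    also have "\<dots> = ?a [^] (- i + 2 ^ (n - 2))" unfolding bb using a by (simp only: int_pow_mult)
    finally show ?thesis by blast
  qed
  \<comment> \<open>Because \<open>b * b\<close> is a power of \<open>a\<close>, the letter for the
    inverse of \<open>b\<close> reduces to the two moves \<open>pb\<close> and
    \<open>pa\<close>.\<close>
  have ib: "inv ?b = ?a [^] (- (2 ^ (n - 2)) :: int) \<otimes> ?b"
  proof (rule inv_equality)
    show "?a [^] (- (2 ^ (n - 2)) :: int) \<otimes> ?b \<otimes> ?b = \<one>"
      using a b by (simp add: m_assoc bb flip: int_pow_mult)
  qed (use a b in auto)
  obtain g e where l: "l = (g, e)" by force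
  let ?w = "word_eval G f u"
  have w: "?w \<in> ?S" by (rule Cons.IH)
  then have wG: "?w \<in> carrier G" using SG by blast
  consider "l = (Gen_a, True)" | "l = (Gen_a, False)" | "l = (Gen_b, True)" | "l = (Gen_b, False)"
    using l by (cases g; cases e) auto
  then show ?case
  proof cases
    case 1 then show ?thesis using pa[OF w, of 1] a by simp
  next
    case 2 then show ?thesis using pa[OF w, of "-1"] a int_pow_neg[of ?a 1] by simp
  next
    case 3 then show ?thesis using pb[OF w] by simp
  next
    case 4 then show ?thesis using pa[OF pb[OF w], of "- (2 ^ (n - 2))"] ib a b wG by (simp add: m_assoc)
  qed
qed

text \<open>Exponents of \<open>a\<close> count only modulo \<open>2 ^ (n - 1)\<close>, and there
  are two families of normal forms. This is only an upper bound, since normal forms may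
  coincide.\<close>

lemma card_quaternion_words_le:
  assumes pair: "quaternion_pair G n a b" and n: "1 \<le> n"
  defines "S \<equiv> range (\<lambda>i::int. a [^] i) \<union> range (\<lambda>i::int. a [^] i \<otimes> b)"
  shows "finite S" "card S \<le> 2 ^ n"
proof -
  have a: "a \<in> carrier G" and N: "a [^] (2 ^ (n - 1) :: int) = \<one>"
    using pair int_pow_int[of G a "2 ^ (n - 1)"] by (auto simp: quaternion_pair_def)
  let ?I = "{0..<2 ^ (n - 1) :: int}"
  have red: "a [^] i = a [^] (i mod 2 ^ (n - 1))" for i :: int
  proof -
    have "a [^] i = a [^] (2 ^ (n - 1) * (i div 2 ^ (n - 1)) + i mod 2 ^ (n - 1))" by simp
    also have "\<dots> = (a [^] (2 ^ (n - 1) :: int)) [^] (i div 2 ^ (n - 1)) \<otimes> a [^] (i mod 2 ^ (n - 1))"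
      using a unfolding int_pow_pow[OF a] by (rule int_pow_mult)
    finally show ?thesis using a N by simp
  qed
  have I: "i mod 2 ^ (n - 1) \<in> ?I" for i by simp
  have S: "S \<subseteq> (\<lambda>i. a [^] i) ` ?I \<union> (\<lambda>i. a [^] i \<otimes> b) ` ?I" (is "_ \<subseteq> ?T")
  proof
    fix x assume "x \<in> S"
    then consider i :: int where "x = a [^] i" | i :: int where "x = a [^] i \<otimes> b"
      unfolding S_def by blast
    then show "x \<in> ?T"
      by cases (use red I in \<open>metis UnI1 UnI2 image_eqI\<close>)+
  qed
  have fin: "finite ?T" by simp
  show "finite S" using S fin by (rule finite_subset)
  have "card S \<le> card ?T" using S fin by (intro card_mono)
  also have "\<dots> \<le> card ((\<lambda>i. a [^] i) ` ?I) + card ((\<lambda>i. a [^] i \<otimes> b) ` ?I)" by (rule card_Un_le)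
  also have "\<dots> \<le> card ?I + card ?I" by (intro add_mono card_image_le) auto
  also have "\<dots> = 2 * 2 ^ (n - 1)" by (simp add: nat_power_eq)
  also have "\<dots> = 2 ^ n" using n by (metis Suc_diff_1 less_eq_Suc_le One_nat_def power_Suc)
  finally show "card S \<le> 2 ^ n" .
qed

text \<open>The universal property maps the presented group onto \<open>G\<close>. Its normal forms
  bound its order by \<open>2 ^ n\<close>, the order of \<open>G\<close>, so the surjection is
  bijective.\<close>

lemma quaternion_pair_imp_generalized_quaternion:
  assumes pair: "quaternion_pair G n a b" and n: "3 \<le> n" and ord: "order G = 2 ^ n"
    and gen: "carrier G = range (\<lambda>i::int. a [^] i) \<union> range (\<lambda>i::int. a [^] i \<otimes> b)"
  shows "generalized_quaternion_2_group G"
proof -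
  let ?P = "presented_group (quat_relations n)" and ?c = "pres_class (quat_relations n)"
  interpret P: group ?P by (rule group_presented_group)
  let ?f = "case_quat_gen a b"
  have ab: "a \<in> carrier G" "b \<in> carrier G" using pair by (auto simp: quaternion_pair_def)
  then have rf: "range ?f \<subseteq> carrier G" by (simp add: range_quat_gen)
  have "\<And>u v. (u, v) \<in> quat_relations n \<Longrightarrow> word_eval G ?f u = word_eval G ?f v"
    using quaternion_pair_iff[of ?f n] pair ab by auto
  from presented_group_universal[OF rf this] obtain h where
    h: "h \<in> hom ?P G" "\<And>u. h (?c u) = word_eval G ?f u" by blast
  interpret h: group_hom ?P G h
    using h(1) by (simp add: group_hom_def group_hom_axioms_def P.group_axioms group_axioms)
  let ?A = "?c [(Gen_a, True)]" and ?B = "?c [(Gen_b, True)]"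
  have hA: "h ?A = a" and hB: "h ?B = b" using h(2) ab by simp_all
  have PAB: "?A \<in> carrier ?P" "?B \<in> carrier ?P" by (simp_all add: presented_group_def)
  have "carrier G \<subseteq> h ` carrier ?P"
  proof
    fix g assume "g \<in> carrier G"
    then consider i :: int where "g = a [^] i" | i :: int where "g = a [^] i \<otimes> b" using gen by blast
    then show "g \<in> h ` carrier ?P"
    proof cases
      case 1
      then have "g = h (?A [^]\<^bsub>?P\<^esub> i)" using h.hom_int_pow[OF PAB(1)] hA by simp
      then show ?thesis using PAB P.int_pow_closed by blast
    next
      case 2
      then have "g = h (?A [^]\<^bsub>?P\<^esub> i \<otimes>\<^bsub>?P\<^esub> ?B)"
        using h.hom_int_pow[OF PAB(1)] hA hB PAB by simp
      then show ?thesis using PAB P.int_pow_closed P.m_closed by blast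
    qed
  qed
  then have surj: "h ` carrier ?P = carrier G" by auto
  let ?S = "range (\<lambda>i::int. ?A [^]\<^bsub>?P\<^esub> i) \<union> range (\<lambda>i::int. ?A [^]\<^bsub>?P\<^esub> i \<otimes>\<^bsub>?P\<^esub> ?B)"
  have "carrier ?P \<subseteq> ?S"
  proof
    fix x assume "x \<in> carrier ?P"
    then obtain u where "x = ?c u" by (auto simp: presented_group_def)
    then show "x \<in> ?S"
      using P.quaternion_pair_word_eval[OF quaternion_pair_presented_group[of n], of u]
      by (simp add: word_eval_presented_group)
  qed
  moreover have "finite ?S" "card ?S \<le> 2 ^ n"
    using P.card_quaternion_words_le[OF quaternion_pair_presented_group[of n]] n by simp_all
  ultimately have fin: "finite (carrier ?P)" and "card (carrier ?P) \<le> card (carrier G)"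
    using finite_subset card_mono[of ?S "carrier ?P"] ord unfolding order_def by auto
  then have "inj_on h (carrier ?P)"
    using surj card_image_le[OF fin, of h] by (intro eq_card_imp_inj_on) auto
  then have "h \<in> iso ?P G" using h(1) surj by (simp add: iso_def bij_betw_def)
  then have "G \<cong> ?P" using P.iso_sym is_isoI by blast
  then show ?thesis using n by (auto simp: generalized_quaternion_2_group_def)
qed

end

text \<open>The generators act on \<open>\<complex>\<^sup>2\<close> by \<open>(u, v) \<mapsto> (\<omega> u, \<omega>\<inverse> v)\<close> and \<open>(u, v) \<mapsto> (v, - u)\<close>, where
  \<open>\<omega>\<close> is a primitive root of unity of order \<open>2 ^ (n - 1)\<close>.\<close>

lemma quat_generator_square_nontrivial:
  assumes n: "3 \<le> n"
  shows "pres_class (quat_relations n) [(Gen_b, True), (Gen_b, True)] \<noteq> pres_class (quat_relations n) []"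
proof -
  let ?M = "BijGroup (UNIV :: (complex \<times> complex) set)"
  interpret M: group ?M by (rule group_BijGroup)
  have mult: "f \<otimes>\<^bsub>?M\<^esub> g = f \<circ> g" if "bij f" "bij g" for f g
    using that by (simp add: BijGroup_def Bij_def extensional_def compose_def fun_eq_iff)
  have carr: "f \<in> carrier ?M \<longleftrightarrow> bij f" for f
    by (simp add: BijGroup_def Bij_def extensional_def)
  have one: "\<one>\<^bsub>?M\<^esub> = id" by (auto simp: BijGroup_def)
  \<comment> \<open>With this angle \<open>\<omega> ^ 2 ^ (n - 2)\<close> is \<open>-1\<close>,
    matching the square of \<open>\<beta>\<close>, which is negation on both coordinates.\<close>
  define \<omega> where "\<omega> = cis (pi / 2 ^ (n - 2))"
  define \<alpha> :: "complex \<times> complex \<Rightarrow> _" where "\<alpha> = (\<lambda>(u, v). (\<omega> * u, inverse \<omega> * v))"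
  define \<alpha>' :: "complex \<times> complex \<Rightarrow> _" where "\<alpha>' = (\<lambda>(u, v). (inverse \<omega> * u, \<omega> * v))"
  define \<beta> :: "complex \<times> complex \<Rightarrow> _" where "\<beta> = (\<lambda>(u, v). (v, - u))"
  have w0: "\<omega> \<noteq> 0" by (simp add: \<omega>_def)
  have bij: "bij \<alpha>" "bij \<beta>" "bij \<alpha>'"
  proof -
    show "bij \<alpha>" by (rule o_bij[of \<alpha>']) (auto simp: \<alpha>_def \<alpha>'_def w0 fun_eq_iff)
    show "bij \<alpha>'" by (rule o_bij[of \<alpha>]) (auto simp: \<alpha>_def \<alpha>'_def w0 fun_eq_iff)
    show "bij \<beta>" by (rule o_bij[of "\<lambda>(u, v). (- v, u)"]) (auto simp: \<beta>_def fun_eq_iff)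
  qed
  have pow: "\<alpha> [^]\<^bsub>?M\<^esub> k = (\<lambda>(u, v). (\<omega> ^ k * u, inverse \<omega> ^ k * v))" for k :: nat
  proof (induction k)
    case (Suc k)
    have "bij (\<alpha> [^]\<^bsub>?M\<^esub> k)" using M.nat_pow_closed[of \<alpha> k] bij carr by blast
    then have "\<alpha> [^]\<^bsub>?M\<^esub> Suc k = (\<alpha> [^]\<^bsub>?M\<^esub> k) \<circ> \<alpha>" using mult bij by simp
    then show ?case unfolding Suc.IH by (auto simp: \<alpha>_def fun_eq_iff)
  qed (auto simp: one)
  have w: "\<omega> ^ 2 ^ (n - 2) = -1" unfolding \<omega>_def Complex.DeMoivre by (simp add: cis_pi)
  have nn: "(2::nat) ^ (n - 1) = 2 ^ (n - 2) * 2"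
  proof -
    have "n - 1 = Suc (n - 2)" using n by simp
    then show ?thesis by simp
  qed
  have w': "\<omega> ^ 2 ^ (n - 1) = 1" unfolding nn power_mult w by simp
  have "quaternion_pair ?M n \<alpha> \<beta>"
    unfolding quaternion_pair_def
  proof (intro conjI)
    show c: "\<alpha> \<in> carrier ?M" "\<beta> \<in> carrier ?M" using bij carr by auto
    show "\<alpha> [^]\<^bsub>?M\<^esub> (2 ^ (n - 2) :: nat) = \<beta> \<otimes>\<^bsub>?M\<^esub> \<beta>"
      using bij by (auto simp: pow mult w power_inverse \<beta>_def fun_eq_iff)
    show "\<alpha> [^]\<^bsub>?M\<^esub> (2 ^ (n - 1) :: nat) = \<one>\<^bsub>?M\<^esub>"
      using w' by (auto simp: pow one power_inverse fun_eq_iff)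
    have "inv\<^bsub>?M\<^esub> \<alpha> = \<alpha>'"
      using bij c carr by (intro M.inv_equality) (auto simp: mult one \<alpha>_def \<alpha>'_def w0 fun_eq_iff)
    moreover have "\<alpha> \<otimes>\<^bsub>?M\<^esub> \<beta> = \<beta> \<otimes>\<^bsub>?M\<^esub> \<alpha>'"
      using bij by (auto simp: mult \<alpha>_def \<alpha>'_def \<beta>_def fun_eq_iff)
    ultimately show "inv\<^bsub>?M\<^esub> \<beta> \<otimes>\<^bsub>?M\<^esub> \<alpha> \<otimes>\<^bsub>?M\<^esub> \<beta> = inv\<^bsub>?M\<^esub> \<alpha>"
      using c M.inv_solve_left by (metis M.inv_closed M.m_assoc M.m_closed)
  qed
  let ?f = "case_quat_gen \<alpha> \<beta>"
  have rf: "range ?f \<subseteq> carrier ?M" using bij carr by (simp add: range_quat_gen)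
  have "\<And>u v. (u, v) \<in> quat_relations n \<Longrightarrow> word_eval ?M ?f u = word_eval ?M ?f v"
    using M.quaternion_pair_iff[of ?f n] \<open>quaternion_pair ?M n \<alpha> \<beta>\<close> bij carr by auto
  from M.presented_group_universal[OF rf this] obtain h where
    h: "\<And>u. h (pres_class (quat_relations n) u) = word_eval ?M ?f u" by blast
  have "word_eval ?M ?f [(Gen_b, True), (Gen_b, True)] = \<beta> \<circ> \<beta>"
    using bij carr by (simp add: mult)
  moreover have "(\<beta> \<circ> \<beta>) (1, 0) \<noteq> id (1, 0)" by (simp add: \<beta>_def)
  ultimately have "word_eval ?M ?f [(Gen_b, True), (Gen_b, True)] \<noteq> word_eval ?M ?f []"
    using one by (metis word_eval.simps(1))
  then show ?thesis using h by metis
qed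

text \<open>The canonical generators are transported along an isomorphism; its injectivity preserves
  the nontriviality of the square of \<open>b\<close>.\<close>

lemma (in group) generalized_quaternion_imp_pair:
  assumes "generalized_quaternion_2_group G"
  obtains n a b where "3 \<le> n" "quaternion_pair G n a b" "b \<otimes> b \<noteq> \<one>"
    "carrier G = range (\<lambda>i::int. a [^] i) \<union> range (\<lambda>i::int. a [^] i \<otimes> b)"
proof -
  obtain n where n: "3 \<le> n" "G \<cong> presented_group (quat_relations n)"
    using assms by (auto simp: generalized_quaternion_2_group_def)
  let ?P = "presented_group (quat_relations n)" and ?c = "pres_class (quat_relations n)"
  interpret P: group ?P by (rule group_presented_group)
  obtain h where h: "h \<in> iso ?P G" using iso_sym[OF n(2)] by (auto simp: is_iso_def)
  interpret h: group_hom ?P G h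
    using h by (simp add: group_hom_def group_hom_axioms_def P.group_axioms group_axioms iso_def)
  have inj: "inj_on h (carrier ?P)" and surj: "h ` carrier ?P = carrier G"
    using h by (auto simp: iso_def bij_betw_def)
  let ?g = "\<lambda>g. ?c [(g, True)]"
  have Pc: "?c u \<in> carrier ?P" for u by (simp add: presented_group_def)
  have we: "word_eval G (h \<circ> ?g) u = h (?c u)" for u
    using h.hom_word_eval[of ?g u] Pc by (simp add: word_eval_presented_group image_subset_iff)
  let ?a = "(h \<circ> ?g) Gen_a" and ?b = "(h \<circ> ?g) Gen_b"
  have ab: "?a \<in> carrier G" "?b \<in> carrier G" using Pc by auto
  have "\<forall>(u, v)\<in>quat_relations n. word_eval G (h \<circ> ?g) u = word_eval G (h \<circ> ?g) v"
  proof (clarify)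
    fix u v assume "(u, v) \<in> quat_relations n"
    then have "?c u = ?c v" by (simp add: pres_class_eq_iff pres_eq.rel)
    then show "word_eval G (h \<circ> ?g) u = word_eval G (h \<circ> ?g) v" unfolding we by simp
  qed
  then have pair: "quaternion_pair G n ?a ?b" using quaternion_pair_iff ab by blast
  have "?b \<otimes> ?b = h (?c [(Gen_b, True), (Gen_b, True)])"
    using Pc by (simp add: mult_presented_group flip: h.hom_mult)
  moreover have "\<one> = h (?c [])" using h.hom_one by (simp add: presented_group_def)
  ultimately have nt: "?b \<otimes> ?b \<noteq> \<one>"
    using quat_generator_square_nontrivial[OF n(1)] inj Pc by (metis inj_onD)
  have "carrier G \<subseteq> range (\<lambda>i::int. ?a [^] i) \<union> range (\<lambda>i::int. ?a [^] i \<otimes> ?b)"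
  proof
    fix x assume "x \<in> carrier G"
    then obtain u where "x = h (?c u)" using surj by (auto simp: presented_group_def)
    then show "x \<in> range (\<lambda>i::int. ?a [^] i) \<union> range (\<lambda>i::int. ?a [^] i \<otimes> ?b)"
      using quaternion_pair_word_eval[OF pair, of u] by (simp only: we)
  qed
  moreover have "range (\<lambda>i::int. ?a [^] i) \<union> range (\<lambda>i::int. ?a [^] i \<otimes> ?b) \<subseteq> carrier G"
    using ab by auto
  ultimately show thesis using that[OF n(1) pair nt] by blast
qed

section \<open>From a breaking point to a unique subgroup of order p\<close>

lemma (in group) subgroup_conj_subgroup:
  assumes H: "subgroup H G" and x: "x \<in> carrier G"
  shows "subgroup (conj_subgroup G H x) G"
proof -
  have "(\<lambda>h. inv x \<otimes> h \<otimes> x) \<in> hom G G"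
    using x by (intro homI) (auto simp: m_assoc mult_inv_cancel)
  then interpret h: group_hom G G "\<lambda>h. inv x \<otimes> h \<otimes> x" by unfold_locales
  show ?thesis unfolding conj_subgroup_altdef by (rule h.subgroup_img_is_subgroup[OF H])
qed

lemma (in group) card_subgroup_dvd:
  assumes "subgroup K G" "subgroup L G" "K \<subseteq> L"
  shows "card K dvd card L"
proof -
  interpret L: group "G\<lparr>carrier := L\<rparr>" using assms(2) by (rule subgroup_imp_group)
  have eq: "card (rcosets\<^bsub>G\<lparr>carrier := L\<rparr>\<^esub> K) * card K = card L"
    using L.lagrange[OF subgroup_incl[OF assms]] by (simp add: order_def)
  show ?thesis unfolding eq[symmetric] by (rule dvd_triv_right)
qed

lemma (in group) subgroup_conj_le:
  assumes "K \<subseteq> conj_subgroup G H x" "subgroup H G" "subgroup K G" "x \<in> carrier G"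
  shows "card K dvd card H"
  using card_subgroup_dvd[OF assms(3) subgroup_conj_subgroup[OF assms(2,4)] assms(1)]
    card_conj_subgroup[OF subgroup.subset[OF assms(2)] assms(4)] by simp

text \<open>There are at most \<open>|G : H|\<close> conjugates of \<open>H\<close>, and they all share \<open>\<one>\<close>.\<close>

lemma (in group) conjugates_not_cover:
  assumes fin: "finite (carrier G)" and H: "subgroup H G" "H \<noteq> carrier G"
  shows "\<exists>g\<in>carrier G. \<forall>x\<in>carrier G. g \<notin> conj_subgroup G H x"
proof (rule ccontr)
  assume "\<not> ?thesis"
  then have cover: "\<exists>x\<in>carrier G. g \<in> conj_subgroup G H x" if "g \<in> carrier G" for g
    using that by blast
  have HG: "H \<subseteq> carrier G" and oneH: "\<one> \<in> H"
    using H(1) by (auto simp: subgroup.subset subgroup.one_closed)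
  have finH: "finite H" using HG fin finite_subset by blast
  \<comment> \<open>The conjugate of \<open>H\<close> by \<open>x\<close> depends only on the coset
    \<open>H #> x\<close>, so one chosen representative per coset reaches all conjugates. Replacing
    \<open>x\<close> by \<open>k \<otimes> x\<close> turns \<open>h\<close> into its conjugate
    \<open>?h\<close> in \<open>H\<close>.\<close>
  let ?f = "\<lambda>R. (\<lambda>h. inv (SOME y. y \<in> R) \<otimes> h \<otimes> (SOME y. y \<in> R)) ` (H - {\<one>})"
  have sub: "carrier G - {\<one>} \<subseteq> (\<Union>R\<in>rcosets H. ?f R)"
  proof
    fix g assume g: "g \<in> carrier G - {\<one>}"
    then obtain x h where x: "x \<in> carrier G" and h: "h \<in> H" "g = inv x \<otimes> h \<otimes> x"
      using cover[of g] by (auto simp: conj_subgroup_altdef)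
    let ?R = "H #> x" and ?y = "SOME y. y \<in> H #> x"
    have "x \<in> ?R" by (rule rcos_self[OF x H(1)])
    then have "?y \<in> ?R" by (rule someI)
    then obtain k where k: "k \<in> H" "?y = k \<otimes> x" by (auto simp: r_coset_def)
    have kG: "k \<in> carrier G" "h \<in> carrier G" using k h HG by auto
    let ?h = "k \<otimes> h \<otimes> inv k"
    have "?h \<in> H" using H(1) k h by (simp add: subgroup.m_closed subgroup.m_inv_closed)
    moreover have gh: "g = inv ?y \<otimes> ?h \<otimes> ?y"
    proof -
      have "inv ?y \<otimes> ?h \<otimes> ?y = inv x \<otimes> (inv k \<otimes> (k \<otimes> (h \<otimes> (inv k \<otimes> (k \<otimes> x)))))"
        unfolding k(2) using kG x by (simp add: m_assoc inv_mult_group)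
      also have "\<dots> = g" using mult_inv_cancel[of "inv k"] kG x h(2) by (simp add: m_assoc)
      finally show ?thesis by simp
    qed
    moreover have "?h \<noteq> \<one>"
    proof
      assume "?h = \<one>"
      moreover have "?y \<in> carrier G" using k kG x by simp
      ultimately have "g = \<one>" using gh by simp
      then show False using g by blast
    qed
    ultimately have "g \<in> ?f ?R" by blast
    then show "g \<in> (\<Union>R\<in>rcosets H. ?f R)" using rcosetsI[OF HG x] by blast
  qed
  have finR: "finite (rcosets H)" using fin by (simp add: RCOSETS_def)
  have "card (carrier G - {\<one>}) \<le> card (\<Union>R\<in>rcosets H. ?f R)"
    using sub finR finH by (intro card_mono) auto
  also have "\<dots> \<le> (\<Sum>R\<in>rcosets H. card (?f R))" by (rule card_UN_le[OF finR])
  also have "\<dots> \<le> (\<Sum>R\<in>rcosets H. card (H - {\<one>}))"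
    using finH by (intro sum_mono card_image_le) auto
  also have "\<dots> = card (rcosets H) * (card H - 1)" using oneH by simp
  finally have "order G - 1 \<le> card (rcosets H) * card H - card (rcosets H)"
    using fin by (simp add: order_def diff_mult_distrib2)
  \<comment> \<open>The comparison forces the index of \<open>H\<close> to be \<open>1\<close>,
    against \<open>H\<close> being proper.\<close>
  then have le: "order G - 1 \<le> order G - card (rcosets H)" using lagrange[OF H(1)] by simp
  have pos: "order G > 0" using fin order_gt_0_iff_finite by blast
  have "card (rcosets H) \<noteq> 0" using lagrange[OF H(1)] pos by (metis mult_0 less_irrefl)
  moreover have "card (rcosets H) \<le> order G"
    using lagrange[OF H(1)] pos by (metis dvd_imp_le dvd_triv_left)
  ultimately have "card (rcosets H) = 1" using le by linarith
  then have "card H = card (carrier G)" using lagrange[OF H(1)] by (simp add: order_def)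
  then show False using card_subset_eq[OF fin HG] H(2) by blast
qed

text \<open>In \<open><c>\<close> the \<open>p\<close>-torsion consists of the powers with exponent
  divisible by \<open>p ^ (l - 1)\<close>. For a nontrivial one the cofactor \<open>j'\<close> is
  prime to \<open>p\<close>, and inverting it modulo \<open>p\<close> gives the exponent
  \<open>u = w * i'\<close>.\<close>

lemma (in group) cyclic_p_torsion:
  assumes p: "prime p" and c: "c \<in> carrier G" "ord c = p ^ l"
    and h: "(c [^] (i::int)) [^] p = \<one>" and z: "(c [^] (j::int)) [^] p = \<one>" "c [^] j \<noteq> \<one>"
  shows "\<exists>u::int. c [^] i = (c [^] j) [^] u"
proof -
  have id: "c [^] (k::int) = \<one> \<longleftrightarrow> int p ^ l dvd k" for k
    using int_pow_eq_id[OF c(1), of k] c(2) by simp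
  have ndvd: "\<not> int p ^ l dvd j" using z(2) id by simp
  then obtain l' where l: "l = Suc l'" by (cases l) auto
  have p0: "int p \<noteq> 0" using p by auto
  have d: "int p ^ l' dvd k" if "(c [^] k) [^] p = \<one>" for k
  proof -
    have "(c [^] k) [^] (int p) = \<one>" using that by (simp add: int_pow_int)
    then have "c [^] (k * int p) = \<one>" using c(1) by (simp add: int_pow_pow)
    then have "int p * int p ^ l' dvd int p * k" using id l by (simp add: mult.commute)
    then show ?thesis using p0 by simp
  qed
  obtain i' where i: "i = int p ^ l' * i'" using d[OF h] by blast
  obtain j' where j: "j = int p ^ l' * j'" using d[OF z(1)] by blast
  have "\<not> int p dvd j'" using ndvd j l p0 by simp
  then have "coprime (int p) j'" using p by (simp add: prime_imp_coprime)
  then have "coprime j' (int p)" by (simp add: coprime_commute)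
  then obtain w where "[j' * w = 1] (mod int p)" using cong_solve_coprime_int by blast
  then have "int p dvd j' * w - 1" by (simp add: cong_iff_dvd_diff)
  then have "int p dvd (j' * w - 1) * i'" by (rule dvd_mult2)
  then have "int p ^ l dvd int p ^ l' * ((j' * w - 1) * i')"
    unfolding l power_Suc2 by (rule mult_dvd_mono[OF dvd_refl])
  also have "int p ^ l' * ((j' * w - 1) * i') = j * (w * i') - i" by (simp add: i j algebra_simps)
  finally have "c [^] i = c [^] (j * (w * i'))" using int_pow_eq[OF c(1)] c(2) by simp
  then show ?thesis using c(1) by (metis int_pow_pow)
qed

lemma prime_divisors_imp_power:
  fixes k p :: nat
  assumes "k > 0" "prime p" "\<And>r. \<lbrakk>prime r; r dvd k\<rbrakk> \<Longrightarrow> r = p"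
  shows "\<exists>n. k = p ^ n"
proof -
  have "\<not> is_unit p" "k \<noteq> 0" using assms(1,2) not_prime_unit by auto
  then obtain s m where m: "k = p ^ s * m" "\<not> p dvd m"
    using multiplicity_decompose'[of k p] by blast
  have "m = 1"
  proof (rule ccontr)
    assume "m \<noteq> 1"
    then obtain r where "prime r" "r dvd m" using prime_factor_nat by blast
    then have "r = p" using assms(3)[of r] m(1) by simp
    then show False using m(2) \<open>r dvd m\<close> by simp
  qed
  then show ?thesis using m(1) by auto
qed

section \<open>Consequences of comparability up to conjugacy\<close>

context group
begin

text \<open>Comparability makes the order of each subgroup divide, or be divided by, that of
  \<open>H\<close>. As \<open>H\<close> is proper, some prime power \<open>p ^ k\<close> divides
  \<open>order G\<close> but not \<open>card H\<close>; Sylow's theorem then makes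
  \<open>card H\<close> a power of \<open>p\<close>. A subgroup of any prime order \<open>r\<close>
  is likewise comparable with \<open>H\<close>, so \<open>r = p\<close>.\<close>

lemma comparable_imp_p_group:
  assumes fin: "finite (carrier G)" and H: "subgroup H G" "H \<noteq> {\<one>}" "H \<noteq> carrier G"
    and comp: "\<And>X. subgroup X G \<Longrightarrow> (\<exists>x\<in>carrier G. X \<subseteq> conj_subgroup G H x)
                 \<or> (\<exists>x\<in>carrier G. H \<subseteq> conj_subgroup G X x)"
  obtains p j n where "prime p" "card H = p ^ j" "0 < j" "order G = p ^ n"
proof -
  have HG: "H \<subseteq> carrier G" and oneH: "\<one> \<in> H"
    using H(1) by (auto simp: subgroup.subset subgroup.one_closed)
  have pos: "order G > 0" using fin order_gt_0_iff_finite by blast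
  have card1: "card H \<noteq> 1" using H(2) oneH by (auto simp: card_1_singleton_iff)
  have dvd: "card X dvd card H \<or> card H dvd card X" if X: "subgroup X G" for X
    using comp[OF X] subgroup_conj_le[OF _ H(1) X] subgroup_conj_le[OF _ X H(1)] by blast
  have sylow: "\<exists>X. subgroup X G \<and> card X = q ^ k" if q: "prime q" "q ^ k dvd order G" for q k
  proof -
    obtain m where "order G = q ^ k * m" using q(2) by blast
    then show ?thesis using sylow_thm[OF q(1) group_axioms _ fin] by blast
  qed
  have "\<exists>q k. prime q \<and> q ^ k dvd order G \<and> \<not> q ^ k dvd card H"
  proof (rule ccontr)
    assume *: "\<not> ?thesis"
    have cH: "card H \<noteq> 0" using oneH fin HG finite_subset by (metis card_0_eq empty_iff)
    have "order G dvd card H"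
    proof (rule multiplicity_le_imp_dvd)
      show "order G \<noteq> 0" using pos by simp
      fix q :: nat assume q: "prime q"
      then have "q ^ multiplicity q (order G) dvd card H" using * multiplicity_dvd by blast
      then show "multiplicity q (order G) \<le> multiplicity q (card H)"
        using q cH by (intro multiplicity_geI) (auto simp: prime_gt_1_nat)
    qed
    then have "card (carrier G) \<le> card H" using cH by (simp add: order_def dvd_imp_le)
    then show False using card_seteq[OF fin HG] H(3) by blast
  qed
  then obtain p k where p: "prime p" "p ^ k dvd order G" "\<not> p ^ k dvd card H" by blast
  obtain X where "subgroup X G" "card X = p ^ k" using sylow[OF p(1,2)] by blast
  then have "card H dvd p ^ k" using dvd p(3) by metis
  then obtain j where j: "card H = p ^ j" using p(1) by (metis divides_primepow_nat)
  have j0: "j > 0" using card1 j by (cases j) auto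
  have "r = p" if r: "prime r" "r dvd order G" for r
  proof -
    obtain X where X: "subgroup X G" "card X = r" using sylow[OF r(1), of 1] r by auto
    have "r dvd p ^ j \<or> p ^ j dvd r" using dvd[OF X(1)] X(2) j by simp
    then have "r dvd p \<or> p dvd r" using r(1) j0 by (meson dvd_power dvd_trans prime_dvd_power)
    then show ?thesis using r(1) p(1) primes_dvd_imp_eq by metis
  qed
  then obtain n where "order G = p ^ n" using prime_divisors_imp_power[OF pos p(1)] by blast
  then show thesis using that[OF p(1) j j0] by blast
qed

theorem comparable_imp_unique_order_p:
  assumes fin: "finite (carrier G)" and nc: "\<not> cyclic_group G"
    and H: "subgroup H G" "H \<noteq> {\<one>}" "H \<noteq> carrier G"
    and comp: "\<And>X. subgroup X G \<Longrightarrow> (\<exists>x\<in>carrier G. X \<subseteq> conj_subgroup G H x)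
                 \<or> (\<exists>x\<in>carrier G. H \<subseteq> conj_subgroup G X x)"
  shows "\<exists>p n Z. unique_order_p G p n Z"
proof -
  have HG: "H \<subseteq> carrier G" using H(1) by (rule subgroup.subset)
  obtain p j n where p: "prime p" and j: "card H = p ^ j" "0 < j" and ord: "order G = p ^ n"
    using comparable_imp_p_group[OF fin H comp] by blast
  have gen: "subgroup (generate G {g}) G" if "g \<in> carrier G" for g
    using that generate_is_subgroup by simp
  have ordp: "\<exists>k. ord y = p ^ k" if "y \<in> carrier G" for y
    using ord_dvd_group_order[OF that] ord p by (metis divides_primepow_nat)
  obtain g where g: "g \<in> carrier G" "\<And>x. x \<in> carrier G \<Longrightarrow> g \<notin> conj_subgroup G H x"
    using conjugates_not_cover[OF fin H(1,3)] by blast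
  have "g \<in> generate G {g}" by (simp add: generate.incl)
  then obtain x where x: "x \<in> carrier G" "H \<subseteq> conj_subgroup G (generate G {g}) x"
    using comp[OF gen[OF g(1)]] g(2) by blast
  \<comment> \<open>The cyclic group of \<open>g\<close> cannot lie below \<open>H\<close>, so one
    of its conjugates contains \<open>H\<close>; \<open>c\<close> generates that conjugate.\<close>
  define c where "c = inv x \<otimes> g \<otimes> x"
  have c: "c \<in> carrier G" using g x by (simp add: c_def)
  have "x \<otimes> c = g \<otimes> x" using g x by (simp add: c_def m_assoc mult_inv_cancel)
  then have cpow: "c [^] i = inv x \<otimes> g [^] i \<otimes> x" for i :: int
    using conj_int_pow[OF c x(1) _ g(1), of i] x(1) c g(1) by (metis int_pow_closed inv_solve_left m_assoc m_closed inv_closed)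
  have Hc: "\<exists>i::int. h = c [^] i" if "h \<in> H" for h
    using that x(2) generate_pow[OF g(1)] cpow by (auto simp: conj_subgroup_altdef)
  obtain l where l: "ord c = p ^ l" using ordp[OF c] by blast

  have "carrier G \<noteq> {\<one>}" using H HG subgroup.one_closed by blast
  then obtain z where z: "z \<in> carrier G" "z \<noteq> \<one>" "\<And>g. g \<in> carrier G \<Longrightarrow> g \<otimes> z = z \<otimes> g"
    using p_group_normal_meets_center[OF p ord normal_self] by blast
  obtain k where k: "ord z = p ^ k" using ordp[OF z(1)] by blast
  have k0: "k \<noteq> 0" using k z by (metis ord_eq_1 power_0)
  \<comment> \<open>A power of the central element \<open>z\<close> that has order exactly
    \<open>p\<close>; it generates the required \<open>Z\<close>.\<close>
  define y where "y = z [^] (p ^ (k - 1))"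
  have y: "y \<in> carrier G" using z(1) by (simp add: y_def)
  have central: "y \<otimes> g = g \<otimes> y" if "g \<in> carrier G" for g
    unfolding y_def using group_commutes_pow[OF z(3)[OF that, symmetric] z(1) that] .
  have yp: "y [^] p = \<one>"
    using k k0 pow_ord_eq_1[OF z(1)] power_minus_mult[of k p] z(1) by (simp add: y_def nat_pow_pow)
  have y1: "y \<noteq> \<one>"
  proof
    assume "y = \<one>"
    then have "p ^ k dvd p ^ (k - 1)" using pow_eq_id[OF z(1)] k by (simp add: y_def)
    then have "k \<le> k - 1" using power_dvd_imp_le prime_gt_1_nat[OF p] by blast
    then show False using k0 by simp
  qed
  have ord_p: "ord w = p" if "w \<in> carrier G" "w \<noteq> \<one>" "w [^] p = \<one>" for w
    using that pow_eq_id[of w p] ord_eq_1[of w] p by (metis prime_nat_iff)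
  have in_conj: "\<exists>x\<in>carrier G. w \<in> conj_subgroup G H x" if w: "w \<in> carrier G" "ord w = p" for w
  proof -
    let ?X = "generate G {w}"
    have wX: "w \<in> ?X" by (simp add: generate.incl)
    have XG: "?X \<subseteq> carrier G" using w generate_incl by simp
    have cX: "card ?X = p" using generate_pow_card[OF w(1)] w(2) by simp
    consider x where "x \<in> carrier G" "?X \<subseteq> conj_subgroup G H x"
      | x where "x \<in> carrier G" "H \<subseteq> conj_subgroup G ?X x" using comp[OF gen[OF w(1)]] by blast
    then show ?thesis
    proof cases
      case 1 then show ?thesis using wX by blast
    next
      \<comment> \<open>Here \<open>H\<close> lies in a group of order \<open>p\<close> but has at
        least \<open>p\<close> elements, so it equals that conjugate, and conjugating back puts
        \<open>w\<close> into a conjugate of \<open>H\<close>.\<close>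
      case (2 x)
      have "finite (conj_subgroup G ?X x)"
        using conj_subgroup_closed[OF XG 2(1)] fin finite_subset by blast
      moreover have "card (conj_subgroup G ?X x) \<le> card H"
        using card_conj_subgroup[OF XG 2(1)] cX j prime_gt_0_nat[OF p] by (simp add: self_le_power)
      ultimately have "H = conj_subgroup G ?X x" using card_seteq 2(2) by metis
      then have "conj_subgroup G H (inv x) = ?X"
        using conj_subgroup_mult[OF XG 2(1), of "inv x"] conj_subgroup_one[OF XG] 2(1) by simp
      then show ?thesis using wX 2(1) inv_closed by metis
    qed
  qed
  \<comment> \<open>Some conjugate of \<open>y\<close> lies in \<open>H\<close>; since
    \<open>y\<close> is central, \<open>y\<close> itself does, and so it is a power of
    \<open>c\<close>.\<close>
  obtain i' where i': "y = c [^] (i' :: int)"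
  proof -
    obtain x h where x: "x \<in> carrier G" "h \<in> H" "y = inv x \<otimes> h \<otimes> x"
      using in_conj[OF y ord_p[OF y y1 yp]] by (auto simp: conj_subgroup_altdef)
    have hG: "h \<in> carrier G" using x(2) HG by blast
    have "x \<otimes> y = h \<otimes> x" using x(1,3) hG by (simp add: m_assoc mult_inv_cancel)
    then have "h = y" using central[OF x(1)] x(1) hG y by (metis right_cancel)
    then show ?thesis using Hc x(2) that by blast
  qed
  \<comment> \<open>A nontrivial \<open>w\<close> is conjugate to some \<open>h\<close> in
    \<open>H\<close>. Both \<open>h\<close> and \<open>y\<close> are \<open>p\<close>-torsion in the
    cyclic group \<open><c>\<close>, so \<open>h\<close> is a power of \<open>y\<close>, hence
    central and equal to \<open>w\<close>.\<close>
  have tors: "w \<in> generate G {y}" if w: "w \<in> carrier G" "w [^] p = \<one>" for w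
  proof (cases "w = \<one>")
    case True then show ?thesis by (simp add: generate.one)
  next
    case False
    obtain x h where x: "x \<in> carrier G" "h \<in> H" "w = inv x \<otimes> h \<otimes> x"
      using in_conj[OF w(1) ord_p[OF w(1) False w(2)]] by (auto simp: conj_subgroup_altdef)
    have hG: "h \<in> carrier G" using x(2) HG by blast
    have xw: "x \<otimes> w = h \<otimes> x" using x(1,3) hG by (simp add: m_assoc mult_inv_cancel)
    have "h [^] p \<otimes> x = \<one> \<otimes> x"
      using conj_int_pow[OF w(1) x(1) xw hG, of "int p"] w(2) x(1) by (simp add: int_pow_int)
    then have hp: "h [^] p = \<one>" using x(1) hG by simp
    obtain i :: int where i: "h = c [^] i" using Hc[OF x(2)] by blast
    obtain u :: int where u: "h = y [^] u"
      using cyclic_p_torsion[OF p c l, of i i'] hp yp y1 i i' by metis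
    have "x \<otimes> y = y \<otimes> x" using central[OF x(1)] by simp
    then have "x \<otimes> h = h \<otimes> x" using conj_int_pow[OF y x(1) _ y, of u] u by simp
    then have "x \<otimes> w = x \<otimes> h" using xw by simp
    then have "w = h" using x(1) hG w(1) by simp
    then show ?thesis using u generate_pow[OF y] by blast
  qed
  have "unique_order_p G p n (generate G {y})"
  proof unfold_locales
    show "card (generate G {y}) = p" using generate_pow_card[OF y] ord_p[OF y y1 yp] by simp
    fix u g assume u: "u \<in> generate G {y}" and g: "g \<in> carrier G"
    then obtain i :: int where "u = y [^] i" using generate_pow[OF y] by blast
    then show "g \<otimes> u = u \<otimes> g" using conj_int_pow[OF y g _ y, of i] central[OF g] by simp
  qed (use p ord nc tors in auto)
  then show ?thesis by blast
qed

end

section \<open>Breaking points in terms of representatives, and the equivalence\<close>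

lemma (in group) breaking_point_iff:
  "(\<exists>\<H>\<in>carrier (subgroup_class_poset G). is_breaking_point G \<H>) \<longleftrightarrow>
     (\<exists>H. subgroup H G \<and> H \<noteq> {\<one>} \<and> H \<noteq> carrier G \<and>
       (\<forall>X. subgroup X G \<longrightarrow> (\<exists>x\<in>carrier G. X \<subseteq> conj_subgroup G H x)
          \<or> (\<exists>x\<in>carrier G. H \<subseteq> conj_subgroup G X x)))"
proof -
  have carr: "carrier (subgroup_class_poset G) = subgroup_conj_class G ` {X. subgroup X G}"
    by (auto simp: subgroup_class_poset_def)
  define C where "C H \<longleftrightarrow> (\<forall>X. subgroup X G \<longrightarrow> (\<exists>x\<in>carrier G. X \<subseteq> conj_subgroup G H x)
      \<or> (\<exists>x\<in>carrier G. H \<subseteq> conj_subgroup G X x))" for H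
  define D where "D \<H> \<longleftrightarrow> (\<forall>\<X>\<in>carrier (subgroup_class_poset G).
      \<X> \<sqsubseteq>\<^bsub>subgroup_class_poset G\<^esub> \<H> \<or> \<H> \<sqsubseteq>\<^bsub>subgroup_class_poset G\<^esub> \<X>)" for \<H>
  have comp: "D (subgroup_conj_class G H) \<longleftrightarrow> C H" if "subgroup H G" for H
    using that unfolding C_def D_def carr by (auto simp: subgroup_class_le_iff)
  have "is_breaking_point G \<H> \<longleftrightarrow> (\<exists>H. subgroup H G \<and> \<H> = subgroup_conj_class G H
      \<and> H \<noteq> {\<one>} \<and> H \<noteq> carrier G \<and> C H)" for \<H>
    unfolding is_breaking_point_def D_def[symmetric] using comp by blast
  then show ?thesis unfolding C_def[symmetric] carr by blast
qed

text \<open>A nontrivial \<open>y = a ^ i\<close> with \<open>i = 2 ^ s * c\<close> and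
  \<open>c\<close> odd has the power \<open>a ^ (2 ^ (n - 2) * c)\<close>, which equals
  \<open>b * b\<close>. An element \<open>a ^ i * b\<close> already squares to
  \<open>b * b\<close>.\<close>

lemma (in group) quaternion_pair_involution_in_subgroup:
  assumes pair: "quaternion_pair G n a b" and n: "3 \<le> n"
    and gen: "carrier G = range (\<lambda>i::int. a [^] i) \<union> range (\<lambda>i::int. a [^] i \<otimes> b)"
    and X: "subgroup X G" "X \<noteq> {\<one>}"
  shows "b \<otimes> b \<in> X"
proof -
  have a: "a \<in> carrier G" and b: "b \<in> carrier G" and bb: "b \<otimes> b = a [^] (2 ^ (n - 2) :: int)"
    and N: "a [^] (2 ^ (n - 1) :: int) = \<one>"
    using pair int_pow_int[of G a "2 ^ (n - 2)"] int_pow_int[of G a "2 ^ (n - 1)"]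
    by (auto simp: quaternion_pair_def)
  have period: "a [^] (2 ^ (n - 1) * k) = \<one>" for k :: int
    using int_pow_pow[OF a, of "2 ^ (n - 1)" k] N by simp
  obtain y where y: "y \<in> X" "y \<noteq> \<one>" using X subgroup.one_closed by blast
  then have "y \<in> carrier G" using X(1) subgroup.subset by blast
  then consider i :: int where "y = a [^] i" | i :: int where "y = a [^] i \<otimes> b" using gen by blast
  then show ?thesis
  proof cases
    case (1 i)
    then have "i \<noteq> 0" using y by auto
    then obtain s c where i: "i = 2 ^ s * c" "odd c"
      using multiplicity_decompose'[of i 2, OF _ odd_one] by blast
    \<comment> \<open>A larger \<open>s\<close> would make \<open>y\<close> trivial; the bound also
      ensures that the subtraction \<open>n - 2 - s\<close> is not truncated.\<close>
    have "s < n - 1"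
    proof (rule ccontr)
      assume "\<not> s < n - 1"
      then have "(2::int) ^ (n - 1) dvd i" using i by (simp add: le_imp_power_dvd)
      then show False using 1 y period by (auto elim: dvdE)
    qed
    then have e: "s + (n - 2 - s) = n - 2" by simp
    obtain d where d: "c = 2 * d + 1" using i(2) oddE by blast
    have "n - 1 = Suc (n - 2)" using n by simp
    then have "i * 2 ^ (n - 2 - s) = 2 ^ (n - 1) * d + 2 ^ (n - 2)"
      using e power_add[of "2::int" s "n - 2 - s"] by (simp add: i d algebra_simps)
    then have "y [^] (2 ^ (n - 2 - s) :: int) = b \<otimes> b"
      using a b 1 bb period by (simp add: int_pow_pow int_pow_mult)
    then show ?thesis using subgroup_int_pow_closed[OF X(1) y(1)] by metis
  next
    case (2 i)
    then have "y \<otimes> y = b \<otimes> b" using quaternion_pair_square[OF pair] by simp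
    then show ?thesis using subgroup.m_closed[OF X(1) y(1) y(1)] by simp
  qed
qed

theorem corollary2:
  fixes G :: "('a, 'b) monoid_scheme"
  assumes "group G" and "finite (carrier G)" and "\<not> cyclic_group G"
  shows "(\<exists>\<H>\<in>carrier (subgroup_class_poset G). is_breaking_point G \<H>)
           \<longleftrightarrow> generalized_quaternion_2_group G"
proof -
  interpret group G by (rule assms(1))
  show ?thesis
    unfolding breaking_point_iff
  proof
    assume "\<exists>H. subgroup H G \<and> H \<noteq> {\<one>\<^bsub>G\<^esub>} \<and> H \<noteq> carrier G \<and>
       (\<forall>X. subgroup X G \<longrightarrow> (\<exists>x\<in>carrier G. X \<subseteq> conj_subgroup G H x)
          \<or> (\<exists>x\<in>carrier G. H \<subseteq> conj_subgroup G X x))"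
    then obtain p n Z where "unique_order_p G p n Z"
      using comparable_imp_unique_order_p[OF assms(2,3)] by metis
    then interpret unique_order_p G p n Z .
    obtain a x m where gens: "a \<in> carrier G" "x \<in> carrier G" "2 \<le> m" "order G = 2 ^ (m + 1)"
      "a [^]\<^bsub>G\<^esub> (2 ^ (m - 1) :: nat) = x \<otimes>\<^bsub>G\<^esub> x" "a [^]\<^bsub>G\<^esub> (2 ^ m :: nat) = \<one>\<^bsub>G\<^esub>"
      "inv\<^bsub>G\<^esub> x \<otimes>\<^bsub>G\<^esub> a \<otimes>\<^bsub>G\<^esub> x = inv\<^bsub>G\<^esub> a"
      "carrier G = range (\<lambda>i::int. a [^]\<^bsub>G\<^esub> i) \<union> range (\<lambda>i::int. a [^]\<^bsub>G\<^esub> i \<otimes>\<^bsub>G\<^esub> x)"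
      by (rule quaternion_generators)
    then have "quaternion_pair G (m + 1) a x" by (simp add: quaternion_pair_def)
    then show "generalized_quaternion_2_group G"
      using quaternion_pair_imp_generalized_quaternion gens(3,4,8) by simp
  next
    assume "generalized_quaternion_2_group G"
    then obtain n a b where q: "3 \<le> n" "quaternion_pair G n a b" "b \<otimes>\<^bsub>G\<^esub> b \<noteq> \<one>\<^bsub>G\<^esub>"
      and gen: "carrier G = range (\<lambda>i::int. a [^]\<^bsub>G\<^esub> i) \<union> range (\<lambda>i::int. a [^]\<^bsub>G\<^esub> i \<otimes>\<^bsub>G\<^esub> b)"
      by (rule generalized_quaternion_imp_pair)
    let ?z = "b \<otimes>\<^bsub>G\<^esub> b"
    have z: "?z \<in> carrier G" using q(2) by (simp add: quaternion_pair_def)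
    \<comment> \<open>The breaking point is the class of the subgroup generated by
      \<open>b * b\<close>: every nontrivial subgroup contains it, and it is proper because it is
      cyclic while \<open>G\<close> is not.\<close>
    let ?H = "generate G {?z}"
    have H: "subgroup ?H G" using z by (simp add: generate_is_subgroup)
    have "?z \<in> ?H" by (simp add: generate.incl)
    then have H1: "?H \<noteq> {\<one>\<^bsub>G\<^esub>}" using q(3) by blast
    have "?H = range (\<lambda>i::int. ?z [^]\<^bsub>G\<^esub> i)" using generate_pow[OF z] by auto
    then have H2: "?H \<noteq> carrier G" using assms(3) z unfolding cyclic_group by blast
    have "(\<exists>x\<in>carrier G. X \<subseteq> conj_subgroup G ?H x) \<or> (\<exists>x\<in>carrier G. ?H \<subseteq> conj_subgroup G X x)"
      if X: "subgroup X G" for X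
    proof (cases "X = {\<one>\<^bsub>G\<^esub>}")
      case True
      then have "X \<subseteq> conj_subgroup G ?H \<one>\<^bsub>G\<^esub>"
        using conj_subgroup_one[OF subgroup.subset[OF H]] subgroup.one_closed[OF H] by simp
      then show ?thesis by blast
    next
      case False
      then have "?H \<subseteq> X"
        using quaternion_pair_involution_in_subgroup[OF q(2,1) gen X] generate_subgroup_incl[OF _ X] by simp
      then have "?H \<subseteq> conj_subgroup G X \<one>\<^bsub>G\<^esub>" using conj_subgroup_one[OF subgroup.subset[OF X]] by simp
      then show ?thesis by blast
    qed
    then show "\<exists>H. subgroup H G \<and> H \<noteq> {\<one>\<^bsub>G\<^esub>} \<and> H \<noteq> carrier G \<and>
       (\<forall>X. subgroup X G \<longrightarrow> (\<exists>x\<in>carrier G. X \<subseteq> conj_subgroup G H x)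
          \<or> (\<exists>x\<in>carrier G. H \<subseteq> conj_subgroup G X x))"
      using H H1 H2 by blast
  qed
qed

end
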